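(* Let $q\in L^1(0,\infty)$ be real-valued and let $H^D$ be the self-adjoint operator in $L^2(0,\infty)$ given by $H^D\varphi=-\varphi''+(x+q(x))\varphi$ on the domain of $\varphi\in L^2(0,\infty)$ with $\varphi,\varphi'$ locally absolutely continuous on $[0,\infty)$, $-\varphi''+(x+q)\varphi\in L^2(0,\infty)$, and $\varphi(0)=0$. Let $\lambda_1^D<\lambda_2^D<\cdots$ be its (simple) eigenvalues, and define the norming constants $\nu_k^D$ by \[ \frac{1}{\nu_k^D}=\frac{\|\varphi_k\|_{L^2(0,\infty)}^2}{\big(\varphi_k'(0)\big)^2}, \] where $\varphi_k$ is any nonzero eigenfunction of $H^D$ for $\lambda_k^D$. Then \[ \frac{1}{\nu_k^D}=1+o(1),\qquad k\to\infty. \]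
   Context: The quotient defining $\nu_k^D$ does not depend on the choice of the (one-dimensional) eigenfunction $\varphi_k$. *)

theory Defs
  imports "HOL-Analysis.Analysis"
begin

text \<open>Real-valued eigenpairs of the Dirichlet Stark-type operator
  H^D phi = - phi'' + (x + q x) phi on L^2(0,infinity), phi(0) = 0.
  phi is differentiable on [0,infinity) with derivative dphi, and dphi is locally
  absolutely continuous with a.e. derivative (x + q x - lambda) phi x
  (this is exactly the eigenvalue equation -phi'' + (x+q) phi = lambda phi),
  phi is square integrable, and phi is not identically zero.\<close>

definition dirichlet_eigenpair ::
  "(real \<Rightarrow> real) \<Rightarrow> real \<Rightarrow> (real \<Rightarrow> real) \<Rightarrow> (real \<Rightarrow> real) \<Rightarrow> bool" where
  "dirichlet_eigenpair q lam phi dphi \<longleftrightarrow>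
     (\<forall>x\<ge>0. (phi has_real_derivative dphi x) (at x within {0..})) \<and>
     (\<forall>x\<ge>0. ((\<lambda>t. (t + q t - lam) * phi t) absolutely_integrable_on {0..x}) \<and>
             ((\<lambda>t. (t + q t - lam) * phi t) has_integral (dphi x - dphi 0)) {0..x}) \<and>
     phi 0 = 0 \<and>
     (\<lambda>x. (phi x)\<^sup>2) integrable_on {0..} \<and>
     (\<exists>x\<ge>0. phi x \<noteq> 0)"

definition dirichlet_eigenvalue :: "(real \<Rightarrow> real) \<Rightarrow> real \<Rightarrow> bool" where
  "dirichlet_eigenvalue q lam \<longleftrightarrow> (\<exists>phi dphi. dirichlet_eigenpair q lam phi dphi)"

end

theory Submission
  imports Defs "HOL-Complex_Analysis.Great_Picard"
begin

text \<open>
  Differentiating \<open>phi'\<^sup>2 + (lam - x) phi\<^sup>2\<close> gives \<open>2 q phi phi' - phi\<^sup>2\<close>. This energy vanishes at infinity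
  and equals \<open>phi'(0)\<^sup>2\<close> at 0, so the norm of \<open>phi\<close> satisfies
  \<open>\<integral> phi\<^sup>2 = phi'(0)\<^sup>2 + 2 \<integral> q phi phi'\<close>, and it remains to see that the last integral is small
  compared with \<open>phi'(0)\<^sup>2\<close> when \<open>lam\<close> is large.
  On \<open>[0, lam/2]\<close> the energy stays below \<open>2 phi'(0)\<^sup>2\<close>, whence \<open>\<bar>phi phi'\<bar> \<le> phi'(0)\<^sup>2 / \<surd>(lam/2)\<close>.
  On \<open>[lam/2, \<infinity>)\<close> it suffices that \<open>\<bar>phi phi'\<bar>\<close> is at most a constant times \<open>phi'(0)\<^sup>2\<close>, because the integral
  of \<open>\<bar>q\<bar>\<close> over this half-line tends to 0. The bound is carried from \<open>lam - 1/16\<close> to \<open>lam + 1/16\<close> across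
  the turning point by the energy \<open>phi'\<^sup>2 + phi\<^sup>2/16\<close>, and beyond it by integrating
  \<open>(phi phi')' = phi'\<^sup>2 + (x - lam + q) phi\<^sup>2\<close> up to infinity.
  Finally the eigenvalues tend to infinity, by orthogonality of eigenfunctions and the
  Arzela-Ascoli theorem.
\<close>

section \<open>Locally absolutely continuous functions on the half-line\<close>

text \<open>On \<open>[0, \<infinity>)\<close>, the function \<open>F\<close> is locally absolutely continuous with almost everywhere derivative \<open>f\<close>.\<close>

definition primitive_of :: "(real \<Rightarrow> real) \<Rightarrow> (real \<Rightarrow> real) \<Rightarrow> bool" where
  "primitive_of F f \<longleftrightarrow>
     (\<forall>x\<ge>0. f absolutely_integrable_on {0..x} \<and> (f has_integral (F x - F 0)) {0..x})"

lemma primitive_of_abs_integrable: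
  assumes "primitive_of F f" "0 \<le> x"
  shows "f absolutely_integrable_on {x..y}"
proof (cases "x \<le> y")
  case True
  then have "f absolutely_integrable_on {0..y}"
    using assms by (auto simp: primitive_of_def)
  then show ?thesis
    using assms(2) by (auto intro: absolutely_integrable_on_subinterval)
qed auto

lemma primitive_of_has_integral:
  assumes F: "primitive_of F f" and x: "0 \<le> x" "x \<le> y"
  shows "(f has_integral (F y - F x)) {x..y}"
proof -
  have i: "f integrable_on {0..y}" "integral {0..y} f = F y - F 0"
    using F x by (auto simp: primitive_of_def has_integral_iff)
  have j: "integral {0..x} f = F x - F 0"
    using F x by (auto simp: primitive_of_def has_integral_iff)
  have "integral {0..x} f + integral {x..y} f = integral {0..y} f"
    using Henstock_Kurzweil_Integration.integral_combine[OF x i(1)] .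
  moreover have "f integrable_on {x..y}"
    using i(1) x by (auto intro: integrable_on_subinterval)
  ultimately show ?thesis
    using i j by (auto simp: has_integral_iff)
qed

lemma primitive_ofI:
  assumes "\<And>x. 0 \<le> x \<Longrightarrow> f absolutely_integrable_on {0..x}"
    and "\<And>x. 0 \<le> x \<Longrightarrow> integral {0..x} f = F x - F 0"
  shows "primitive_of F f"
  using assms by (auto simp: primitive_of_def has_integral_iff set_lebesgue_integral_eq_integral)

lemma primitive_of_bound:
  assumes F: "primitive_of F f" and x: "0 \<le> x" "x \<le> y"
    and g: "g integrable_on {x..y}" "\<And>t. x \<le> t \<Longrightarrow> t \<le> y \<Longrightarrow> \<bar>f t\<bar> \<le> g t"
  shows "\<bar>F y - F x\<bar> \<le> integral {x..y} g"
proof -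
  have "norm (integral {x..y} f) \<le> integral {x..y} g"
    using primitive_of_has_integral[OF F x] g
    by (intro integral_norm_bound_integral) (auto simp: has_integral_iff)
  then show ?thesis
    using primitive_of_has_integral[OF F x] by (simp add: has_integral_iff)
qed

lemma primitive_of_continuous:
  assumes F: "primitive_of F f"
  shows "continuous_on {0..} F"
  unfolding continuous_on_eq_continuous_within
proof
  fix x :: real assume x: "x \<in> {0..}"
  \<comment> \<open>The interval extends beyond \<open>x\<close> so that it contains a neighbourhood
    of \<open>x\<close> in the half-line.\<close>
  have fi: "f integrable_on {0..x+1}"
    using F x by (auto simp: primitive_of_def has_integral_iff)
  have "continuous_on {0..x+1} (\<lambda>t. integral {0..t} f + F 0)"
    by (intro continuous_intros indefinite_integral_continuous_1 fi)
  moreover have "integral {0..t} f + F 0 = F t" if "t \<in> {0..x+1}" for t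
    using F that by (auto simp: primitive_of_def has_integral_iff)
  ultimately have "continuous_on {0..x+1} F"
    by (metis (no_types, lifting) continuous_on_cong)
  then have "continuous (at x within {0..x+1}) F"
    using x by (auto simp: continuous_on_eq_continuous_within)
  moreover have "at x within {0..} = at x within {0..x+1}"
    by (rule at_within_nhd[of x "{..<x+1}"]) auto
  ultimately show "continuous (at x within {0..}) F"
    by simp
qed

lemma continuous_times_abs_integrable:
  fixes h g :: "real \<Rightarrow> real"
  assumes "continuous_on {a..b} h" "g absolutely_integrable_on {a..b}"
  shows "(\<lambda>t. h t * g t) absolutely_integrable_on {a..b}"
proof (rule absolutely_integrable_bounded_measurable_product_real)
  show "h \<in> borel_measurable (lebesgue_on {a..b})"
    using assms by (intro continuous_imp_measurable_on_sets_lebesgue) auto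
  show "bounded (h ` {a..b})"
    using assms by (intro compact_imp_bounded compact_continuous_image) auto
qed (use assms in auto)

lemma bounded_continuous_times_abs_integrable:
  fixes h g :: "real \<Rightarrow> real"
  assumes "continuous_on {a..} h" "\<And>x. a \<le> x \<Longrightarrow> \<bar>h x\<bar> \<le> B" "g absolutely_integrable_on {a..}"
  shows "(\<lambda>t. h t * g t) absolutely_integrable_on {a..}"
proof (rule absolutely_integrable_bounded_measurable_product_real)
  show "h \<in> borel_measurable (lebesgue_on {a..})"
    using assms by (intro continuous_imp_measurable_on_sets_lebesgue) auto
  show "bounded (h ` {a..})"
    using assms(2) by (auto simp: bounded_iff)
qed (use assms in auto)

text \<open>Locally, the defect of the product formula is at most \<open>e\<close> times the integral of
  \<open>\<bar>f\<bar> + \<bar>u\<bar>\<close>, by continuity of \<open>F\<close> and \<open>U\<close>; such bounds add up along subdivisions.\<close>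

lemma primitive_of_mult:
  assumes F: "primitive_of F f" and U: "primitive_of U u"
  shows "primitive_of (\<lambda>x. F x * U x) (\<lambda>x. f x * U x + F x * u x)"
proof (rule primitive_ofI)
  define h where "h = (\<lambda>x. f x * U x + F x * u x)"
  define m where "m = (\<lambda>t. \<bar>f t\<bar> + \<bar>u t\<bar>)"
  note cF = primitive_of_continuous[OF F] and cU = primitive_of_continuous[OF U]
  note aF = primitive_of_abs_integrable[OF F] and aU = primitive_of_abs_integrable[OF U]
  have ah: "h absolutely_integrable_on {x..y}" if "0 \<le> x" for x y
  proof -
    have "(\<lambda>t. U t * f t) absolutely_integrable_on {x..y}"
      using that by (intro continuous_times_abs_integrable aF continuous_on_subset[OF cU]) auto
    moreover have "(\<lambda>t. F t * u t) absolutely_integrable_on {x..y}"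
      using that by (intro continuous_times_abs_integrable aU continuous_on_subset[OF cF]) auto
    ultimately show ?thesis
      unfolding h_def by (auto simp: mult.commute)
  qed
  have im: "m integrable_on {x..y}" if "0 \<le> x" for x y
    unfolding m_def
    by (intro Henstock_Kurzweil_Integration.integrable_add)
      (use aF aU that in \<open>auto simp: absolutely_integrable_on_def\<close>)
  fix x :: real assume x: "0 \<le> x"
  show "(\<lambda>x. f x * U x + F x * u x) absolutely_integrable_on {0..x}"
    using ah[of 0 x] by (simp add: h_def)
  have ih: "h integrable_on {a..b}" if "0 \<le> a" for a b
    using ah that by (auto simp: set_lebesgue_integral_eq_integral)
  have key: "\<bar>F x * U x - F 0 * U 0 - integral {0..x} h\<bar> \<le> e * integral {0..x} m" if e: "e > 0" for e
  proof -
    \<comment> \<open>The bisection principle tests small intervals around a point, and these may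
      start below 0, where nothing is known about \<open>F\<close> and \<open>U\<close>; hence the
      guard \<open>0 \<le> a\<close> in \<open>P\<close>.\<close>
    define P where "P a b \<longleftrightarrow> (0 \<le> a \<longrightarrow> a \<le> b \<longrightarrow>
      \<bar>F b * U b - F a * U a - integral {a..b} h\<bar> \<le> e * integral {a..b} m)" for a b
    have "P 0 x" using x
    proof (induction rule: Bolzano)
      case (trans a b c)
      show ?case unfolding P_def
      proof (intro impI)
        assume a: "0 \<le> a" "a \<le> c"
        have "integral {a..b} h + integral {b..c} h = integral {a..c} h"
          using trans a ih by (intro Henstock_Kurzweil_Integration.integral_combine) auto
        moreover have "integral {a..b} m + integral {b..c} m = integral {a..c} m"
          using trans a im by (intro Henstock_Kurzweil_Integration.integral_combine) auto
        moreover have "\<bar>F b * U b - F a * U a - integral {a..b} h\<bar> \<le> e * integral {a..b} m"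
          "\<bar>F c * U c - F b * U b - integral {b..c} h\<bar> \<le> e * integral {b..c} m"
          using trans a by (auto simp: P_def)
        ultimately show "\<bar>F c * U c - F a * U a - integral {a..c} h\<bar> \<le> e * integral {a..c} m"
          by (smt (verit) distrib_left)
      qed
    next
      case (local z)
      have "z \<in> {0..}" "e/2 > 0" using local e by auto
      then obtain d1 d2 where d: "d1 > 0" "d2 > 0"
        "\<And>t. t \<ge> 0 \<Longrightarrow> \<bar>t - z\<bar> < d1 \<Longrightarrow> \<bar>F t - F z\<bar> < e/2"
        "\<And>t. t \<ge> 0 \<Longrightarrow> \<bar>t - z\<bar> < d2 \<Longrightarrow> \<bar>U t - U z\<bar> < e/2"
        using cF cU unfolding continuous_on_iff dist_real_def by (metis atLeast_iff)
      show ?case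
      proof (rule exI[of _ "min d1 d2"], intro conjI allI impI)
        show "min d1 d2 > 0" using d by simp
        fix a b assume ab: "a \<le> z \<and> z \<le> b \<and> b - a < min d1 d2"
        show "P a b" unfolding P_def
        proof (intro impI)
          assume a: "0 \<le> a" "a \<le> b"
          have cl: "\<bar>F b - F t\<bar> \<le> e" "\<bar>U a - U t\<bar> \<le> e" if "t \<in> {a..b}" for t
          proof -
            have "\<bar>t - z\<bar> < d1" "\<bar>t - z\<bar> < d2" "\<bar>b - z\<bar> < d1" "\<bar>a - z\<bar> < d2" "0 \<le> t" "0 \<le> b"
              using that ab a by auto
            then show "\<bar>F b - F t\<bar> \<le> e" "\<bar>U a - U t\<bar> \<le> e"
              using d(3)[of b] d(3)[of t] d(4)[of a] d(4)[of t] a by linarith+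
          qed
          have hi: "(u has_integral (U b - U a)) {a..b}" "(f has_integral (F b - F a)) {a..b}"
            using primitive_of_has_integral[OF U] primitive_of_has_integral[OF F] a by auto
          \<comment> \<open>The increment of the product is
            \<open>F b * (U b - U a) + U a * (F b - F a)\<close>. Freezing the factors at opposite
            endpoints leaves an integrand with factors \<open>F b - F t\<close> and
            \<open>U a - U t\<close>, both small on a short interval.\<close>
          have "((\<lambda>t. F b * u t + U a * f t - h t) has_integral
              (F b * (U b - U a) + U a * (F b - F a) - integral {a..b} h)) {a..b}"
            by (intro has_integral_diff has_integral_add has_integral_mult_right hi
                integrable_integral ih a)
          then have eq: "F b * U b - F a * U a - integral {a..b} h
              = integral {a..b} (\<lambda>t. F b * u t + U a * f t - h t)"
            and "(\<lambda>t. F b * u t + U a * f t - h t) integrable_on {a..b}"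
            by (auto simp: has_integral_iff algebra_simps)
          have "norm (integral {a..b} (\<lambda>t. F b * u t + U a * f t - h t))
              \<le> integral {a..b} (\<lambda>t. e * m t)"
          proof (rule integral_norm_bound_integral)
            show "(\<lambda>t. e * m t) integrable_on {a..b}"
              by (intro integrable_on_mult_right im a)
            fix t assume t: "t \<in> {a..b}"
            have "F b * u t + U a * f t - h t = (F b - F t) * u t + (U a - U t) * f t"
              by (simp add: h_def algebra_simps)
            also have "norm \<dots> \<le> \<bar>F b - F t\<bar> * \<bar>u t\<bar> + \<bar>U a - U t\<bar> * \<bar>f t\<bar>"
              by (metis abs_mult abs_triangle_ineq real_norm_def)
            also have "\<dots> \<le> e * \<bar>u t\<bar> + e * \<bar>f t\<bar>"
              by (intro add_mono mult_right_mono cl t) auto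
            finally show "norm (F b * u t + U a * f t - h t) \<le> e * m t"
              by (simp add: m_def algebra_simps)
          qed fact
          then show "\<bar>F b * U b - F a * U a - integral {a..b} h\<bar> \<le> e * integral {a..b} m"
            using eq by simp
        qed
      qed
    qed
    then show ?thesis using x by (simp add: P_def)
  qed
  have "\<bar>F x * U x - F 0 * U 0 - integral {0..x} h\<bar> \<le> 0"
  proof (rule field_le_epsilon)
    fix e :: real assume e: "e > 0"
    have m0: "0 \<le> integral {0..x} m"
      by (intro integral_nonneg im) (auto simp: m_def)
    \<comment> \<open>Adding 1 to the integral of \<open>m\<close> keeps the denominator
      positive.\<close>
    have "\<bar>F x * U x - F 0 * U 0 - integral {0..x} h\<bar>
        \<le> e / (integral {0..x} m + 1) * integral {0..x} m"
      using e m0 by (intro key) auto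
    also have "\<dots> \<le> e"
      using e m0 by (simp add: field_simps)
    finally show "\<bar>F x * U x - F 0 * U 0 - integral {0..x} h\<bar> \<le> 0 + e" by simp
  qed
  then show "integral {0..x} (\<lambda>x. f x * U x + F x * u x) = F x * U x - F 0 * U 0"
    by (simp add: h_def)
qed

lemma primitive_of_add:
  assumes "primitive_of F f" "primitive_of U u"
  shows "primitive_of (\<lambda>x. F x + U x) (\<lambda>x. f x + u x)"
  unfolding primitive_of_def
proof (intro allI impI conjI)
  fix x :: real assume x: "0 \<le> x"
  show "(\<lambda>x. f x + u x) absolutely_integrable_on {0..x}"
    using assms x by (auto simp: primitive_of_def)
  have "((\<lambda>x. f x + u x) has_integral ((F x - F 0) + (U x - U 0))) {0..x}"
    using assms x by (intro has_integral_add) (auto simp: primitive_of_def)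
  then show "((\<lambda>x. f x + u x) has_integral (F x + U x - (F 0 + U 0))) {0..x}"
    by (simp add: algebra_simps)
qed

lemma primitive_of_cmult:
  assumes "primitive_of F f"
  shows "primitive_of (\<lambda>x. c * F x) (\<lambda>x. c * f x)"
  unfolding primitive_of_def
proof (intro allI impI conjI)
  fix x :: real assume x: "0 \<le> x"
  show "(\<lambda>x. c * f x) absolutely_integrable_on {0..x}"
    using assms x by (auto simp: primitive_of_def)
  have "((\<lambda>x. c * f x) has_integral (c * (F x - F 0))) {0..x}"
    using assms x by (intro has_integral_mult_right) (auto simp: primitive_of_def)
  then show "((\<lambda>x. c * f x) has_integral (c * F x - c * F 0)) {0..x}"
    by (simp add: algebra_simps)
qed

lemma primitive_of_diff:
  assumes "primitive_of F f" "primitive_of U u"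
  shows "primitive_of (\<lambda>x. F x - U x) (\<lambda>x. f x - u x)"
  using primitive_of_add[OF assms(1) primitive_of_cmult[OF assms(2), of "-1"]] by simp

lemma primitive_of_deriv:
  assumes "\<And>x. 0 \<le> x \<Longrightarrow> (F has_real_derivative f x) (at x within {0..})"
    and "continuous_on {0..} f"
  shows "primitive_of F f"
  unfolding primitive_of_def
proof (intro allI impI conjI)
  fix x :: real assume x: "0 \<le> x"
  show "f absolutely_integrable_on {0..x}"
    using assms(2) by (intro absolutely_integrable_continuous_real continuous_on_subset[OF assms(2)]) auto
  show "(f has_integral (F x - F 0)) {0..x}"
  proof (rule fundamental_theorem_of_calculus[OF x])
    fix t assume "t \<in> {0..x}"
    then have "(F has_real_derivative f t) (at t within {0..x})"
      using assms(1)[of t] by (auto elim: DERIV_subset)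
    then show "(F has_vector_derivative f t) (at t within {0..x})"
      by (simp add: has_real_derivative_iff_has_vector_derivative)
  qed
qed

section \<open>Integrals over half-lines and behaviour at infinity\<close>

lemma abs_integrable_atLeast_mono:
  fixes f :: "real \<Rightarrow> real"
  assumes "f absolutely_integrable_on {a..}" "a \<le> b"
  shows "f absolutely_integrable_on {b..}"
  using assms by (auto intro: set_integrable_subset)

lemma abs_integrable_not_bounded_below:
  fixes F :: "real \<Rightarrow> real"
  assumes F: "F absolutely_integrable_on {0..}" and c: "c > 0"
  shows "\<exists>x\<ge>X. \<bar>F x\<bar> < c"
proof (rule ccontr)
  assume "\<not> ?thesis"
  then have X: "\<And>x. x \<ge> X \<Longrightarrow> c \<le> \<bar>F x\<bar>" by force
  define Y where "Y = max X 0"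
  define I where "I = integral {0..} (\<lambda>x. \<bar>F x\<bar>)"
  \<comment> \<open>With this length the constant \<open>c\<close> integrates to
    \<open>I + 1\<close> over \<open>{Y..Z}\<close>, more than the whole integral of
    \<open>\<bar>F\<bar>\<close>.\<close>
  define Z where "Z = Y + (I + 1) / c"
  have iF: "(\<lambda>x. \<bar>F x\<bar>) integrable_on {0..}"
    using F by (auto simp: absolutely_integrable_on_def)
  have iYZ: "(\<lambda>x. \<bar>F x\<bar>) integrable_on {Y..Z}"
    by (rule integrable_on_subinterval[OF iF]) (auto simp: Y_def)
  have I0: "I \<ge> 0"
    unfolding I_def by (intro integral_nonneg iF) auto
  then have YZ: "Y \<le> Z" unfolding Z_def using c by simp
  have "I + 1 = integral {Y..Z} (\<lambda>x. c)"
    using YZ c by (simp add: Z_def field_simps)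
  also have "\<dots> \<le> integral {Y..Z} (\<lambda>x. \<bar>F x\<bar>)"
    using X by (intro integral_le iYZ) (auto simp: Y_def)
  also have "\<dots> \<le> I"
    unfolding I_def using iF iYZ by (intro integral_subset_le) (auto simp: Y_def)
  finally show False by simp
qed

lemma abs_integrable_tendsto_imp_zero:
  fixes F :: "real \<Rightarrow> real"
  assumes F: "F absolutely_integrable_on {0..}" and L: "(F \<longlongrightarrow> L) at_top"
  shows "L = 0"
proof (rule ccontr)
  assume "L \<noteq> 0"
  then have c: "\<bar>L\<bar>/2 > 0" by simp
  with L have "eventually (\<lambda>x. dist (F x) L < \<bar>L\<bar>/2) at_top"
    by (rule tendstoD)
  then obtain X where X: "\<And>x. x \<ge> X \<Longrightarrow> \<bar>F x - L\<bar> < \<bar>L\<bar>/2"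
    unfolding eventually_at_top_linorder dist_real_def by blast
  obtain x where "x \<ge> X" "\<bar>F x\<bar> < \<bar>L\<bar>/2"
    using abs_integrable_not_bounded_below[OF F c] by blast
  with X[of x] show False by linarith
qed

lemma integral_tendsto_at_top:
  fixes f :: "real \<Rightarrow> real"
  assumes "f absolutely_integrable_on {a..}"
  shows "((\<lambda>b. integral {a..b} f) \<longlongrightarrow> integral {a..} f) at_top"
proof -
  have "((\<lambda>b. LINT x:{a..b}|lebesgue. f x) \<longlongrightarrow> (LINT x:{a..}|lebesgue. f x)) at_top"
    by (rule tendsto_set_lebesgue_integral_at_top[OF _ assms]) auto
  moreover have "(LINT x:{a..b}|lebesgue. f x) = integral {a..b} f" for b
    using assms by (intro set_lebesgue_integral_eq_integral) (auto intro: set_integrable_subset)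
  ultimately show ?thesis
    using assms by (simp add: set_lebesgue_integral_eq_integral)
qed

text \<open>Integrability of the derivative makes \<open>F\<close> converge at infinity, and
  integrability of \<open>F\<close> itself forces the limit to be 0. This removes the boundary term
  at infinity from the identities for eigenfunctions.\<close>

lemma primitive_of_tail:
  assumes F: "primitive_of F f" and f: "f absolutely_integrable_on {0..}"
    and Fi: "F absolutely_integrable_on {0..}" and x: "0 \<le> x"
  shows "integral {x..} f = - F x"
proof -
  have lim: "((\<lambda>y. integral {a..y} f + F a) \<longlongrightarrow> integral {a..} f + F a) at_top"
    if "a \<ge> 0" for a
    using that by (intro tendsto_intros integral_tendsto_at_top abs_integrable_atLeast_mono[OF f])
  have ev: "eventually (\<lambda>y. integral {a..y} f + F a = F y) at_top" if "a \<ge> 0" for a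
    using eventually_ge_at_top[of a]
  proof eventually_elim
    case (elim y)
    then show ?case using primitive_of_has_integral[OF F that, of y] by (simp add: has_integral_iff)
  qed
  have "(F \<longlongrightarrow> integral {x..} f + F x) at_top"
    using Lim_transform_eventually[OF lim ev] x by blast
  then show ?thesis
    using abs_integrable_tendsto_imp_zero[OF Fi] by force
qed

text \<open>The integrals over \<open>{a..y}\<close> increase with \<open>y\<close>, so they
  converge to their supremum.\<close>

lemma integrable_atLeast_if_bounded:
  fixes f :: "real \<Rightarrow> real"
  assumes i: "\<And>y. f integrable_on {a..y}" and nn: "\<And>x. a \<le> x \<Longrightarrow> 0 \<le> f x"
    and B: "\<And>y. a \<le> y \<Longrightarrow> integral {a..y} f \<le> B"
  shows "f absolutely_integrable_on {a..}"
proof -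
  have mono: "mono_on {a..} (\<lambda>y. integral {a..y} f)"
  proof (rule mono_onI)
    fix r s assume "r \<in> {a..}" "s \<in> {a..}" "r \<le> s"
    then show "integral {a..r} f \<le> integral {a..s} f"
      using i nn by (intro integral_subset_le) auto
  qed
  define l where "l = (SUP y\<in>{a..}. integral {a..y} f)"
  have bdd: "bdd_above ((\<lambda>y. integral {a..y} f) ` {a..})"
    using B by (auto simp: bdd_above_def)
  have "((\<lambda>y. integral {a..y} f) \<longlongrightarrow> l) at_top"
  proof (rule order_tendstoI)
    fix c assume "c < l"
    then obtain y where y: "y \<ge> a" "c < integral {a..y} f"
      using bdd by (auto simp: l_def less_cSUP_iff)
    show "eventually (\<lambda>y. c < integral {a..y} f) at_top"
      using eventually_ge_at_top[of y]
    proof eventually_elim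
      case (elim z)
      then show ?case using y mono_onD[OF mono, of y z] by auto
    qed
  next
    fix c assume c: "l < c"
    show "eventually (\<lambda>y. integral {a..y} f < c) at_top"
      using eventually_ge_at_top[of a]
    proof eventually_elim
      case (elim z)
      then have "integral {a..z} f \<le> l" unfolding l_def using bdd by (intro cSUP_upper) auto
      then show ?case using c by simp
    qed
  qed
  then have "(f has_integral l) {a..}"
    using i nn by (intro has_integral_to_inf) auto
  then show ?thesis
    using nn by (intro nonnegative_absolutely_integrable_1) auto
qed

lemma abs_integrable_atLeast_extend:
  fixes f :: "real \<Rightarrow> real"
  assumes "f absolutely_integrable_on {a..b}" "f absolutely_integrable_on {b..}" "a \<le> b"
  shows "f absolutely_integrable_on {a..}"
proof -
  have "{a..} = {a..b} \<union> {b..}" using assms(3) by auto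
  then show ?thesis using assms by (auto intro: absolutely_integrable_Un)
qed

lemma integral_atLeast_split:
  fixes f :: "real \<Rightarrow> real"
  assumes f: "f absolutely_integrable_on {a..}" and "a \<le> b"
  shows "integral {a..} f = integral {a..b} f + integral {b..} f"
proof -
  have "{a..} = {a..b} \<union> {b..}" using assms(2) by auto
  moreover have "integral ({a..b} \<union> {b..}) f = integral {a..b} f + integral {b..} f"
  proof (rule integral_Un)
    show "f integrable_on {a..b}" "f integrable_on {b..}"
      using assms by (auto intro!: set_lebesgue_integral_eq_integral(1) intro: set_integrable_subset)
    show "negligible ({a..b} \<inter> {b..})"
      by (rule negligible_subset[of "{b}"]) auto
  qed
  ultimately show ?thesis by simp
qed

lemma abs_integrable_tail_small:
  fixes f :: "real \<Rightarrow> real"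
  assumes f: "f absolutely_integrable_on {a..}" and e: "e > 0"
  obtains X where "X \<ge> a" "\<And>x. x \<ge> X \<Longrightarrow> integral {x..} (\<lambda>t. \<bar>f t\<bar>) < e"
proof -
  have af: "(\<lambda>t. \<bar>f t\<bar>) absolutely_integrable_on {a..}"
    using f by (rule set_integrable_abs)
  obtain X where X: "\<And>x. x \<ge> X \<Longrightarrow> \<bar>integral {a..x} (\<lambda>t. \<bar>f t\<bar>) - integral {a..} (\<lambda>t. \<bar>f t\<bar>)\<bar> < e"
    using tendstoD[OF integral_tendsto_at_top[OF af] e]
    unfolding eventually_at_top_linorder dist_real_def by blast
  have "integral {x..} (\<lambda>t. \<bar>f t\<bar>) < e" if "x \<ge> max a X" for x
    using X[of x] integral_atLeast_split[OF af, of x] that by auto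
  then show ?thesis using that[of "max a X"] by auto
qed

lemma abs_integrable_atLeast_bound:
  fixes f g :: "real \<Rightarrow> real"
  assumes "continuous_on {a..} f" "g absolutely_integrable_on {a..}"
    and "\<And>x. a \<le> x \<Longrightarrow> \<bar>f x\<bar> \<le> g x"
  shows "f absolutely_integrable_on {a..}"
  using assms
  by (intro measurable_bounded_by_integrable_imp_absolutely_integrable[where g=g]
      continuous_imp_measurable_on_sets_lebesgue)
    (auto simp: set_lebesgue_integral_eq_integral)

lemma square_integrable_product:
  fixes f g :: "real \<Rightarrow> real"
  assumes "continuous_on {a..} f" "continuous_on {a..} g"
    and "(\<lambda>x. (f x)\<^sup>2) absolutely_integrable_on {a..}" "(\<lambda>x. (g x)\<^sup>2) absolutely_integrable_on {a..}"
  shows "(\<lambda>x. f x * g x) absolutely_integrable_on {a..}"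
proof (rule abs_integrable_atLeast_bound)
  show "continuous_on {a..} (\<lambda>x. f x * g x)"
    using assms by (intro continuous_intros)
  show "(\<lambda>x. (f x)\<^sup>2 + (g x)\<^sup>2) absolutely_integrable_on {a..}"
    by (intro set_integral_add assms)
  show "\<bar>f x * g x\<bar> \<le> (f x)\<^sup>2 + (g x)\<^sup>2" for x
    using sum_squares_bound[of "\<bar>f x\<bar>" "\<bar>g x\<bar>"] mult_nonneg_nonneg[of "\<bar>f x\<bar>" "\<bar>g x\<bar>"]
    unfolding power2_abs abs_mult by linarith
qed

section \<open>Decay and integral identities of an eigenfunction\<close>

text \<open>The eigenvalue equation as a first-order system: with both \<open>phi\<close> and
  \<open>dphi\<close> given as primitives, the product rule applies to every quadratic expression in
  them.\<close>

locale stark_solution =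
  fixes q :: "real \<Rightarrow> real" and lam :: real and phi dphi :: "real \<Rightarrow> real"
  assumes q: "q absolutely_integrable_on {0..}"
    and phi: "primitive_of phi dphi"
    and dphi: "primitive_of dphi (\<lambda>t. (t + q t - lam) * phi t)"
    and phi0: "phi 0 = 0"
    and phi_sq: "(\<lambda>x. (phi x)\<^sup>2) absolutely_integrable_on {0..}"
    and nontrivial: "\<exists>x\<ge>0. phi x \<noteq> 0"
begin

lemma cont: "continuous_on {0..} phi" "continuous_on {0..} dphi"
  using primitive_of_continuous phi dphi by blast+

lemma q_tail_integrable: "0 \<le> x \<Longrightarrow> (\<lambda>t. \<bar>q t\<bar>) integrable_on {x..}"
  and q_interval_integrable: "0 \<le> x \<Longrightarrow> (\<lambda>t. \<bar>q t\<bar>) integrable_on {x..y}"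
proof -
  show *: "0 \<le> x \<Longrightarrow> (\<lambda>t. \<bar>q t\<bar>) integrable_on {x..}" for x
    using abs_integrable_atLeast_mono[OF q, of x] by (auto simp: absolutely_integrable_on_def)
  show "0 \<le> x \<Longrightarrow> (\<lambda>t. \<bar>q t\<bar>) integrable_on {x..y}"
    using *[of 0] by (rule integrable_on_subinterval) auto
qed

lemma q_interval_le_tail:
  "0 \<le> x \<Longrightarrow> integral {x..y} (\<lambda>t. \<bar>q t\<bar>) \<le> integral {x..} (\<lambda>t. \<bar>q t\<bar>)"
  using q_tail_integrable q_interval_integrable by (intro integral_subset_le) auto

lemma primitive_sq: "primitive_of (\<lambda>x. (phi x)\<^sup>2) (\<lambda>x. 2 * (phi x * dphi x))"
  using primitive_of_mult[OF phi phi] by (simp add: power2_eq_square mult.commute)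

text \<open>The bracket is kept together because it is nonnegative for \<open>x \<ge> lam\<close>;
  the \<open>q\<close> term is treated as a perturbation of it.\<close>

lemma primitive_prod:
  "primitive_of (\<lambda>x. phi x * dphi x) (\<lambda>x. ((dphi x)\<^sup>2 + (x - lam) * (phi x)\<^sup>2) + q x * (phi x)\<^sup>2)"
  using primitive_of_mult[OF phi dphi]
  by (rule back_subst[of "primitive_of _"]) (auto simp: fun_eq_iff power2_eq_square algebra_simps)

lemma primitive_dsq:
  "primitive_of (\<lambda>x. (dphi x)\<^sup>2) (\<lambda>x. 2 * (x + q x - lam) * (phi x * dphi x))"
proof -
  have "(\<lambda>x. dphi x * dphi x) = (\<lambda>x. (dphi x)\<^sup>2)" by (simp add: power2_eq_square)
  then show ?thesis
    using primitive_of_mult[OF dphi dphi]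
    by (auto intro: back_subst[of "primitive_of _"] simp: fun_eq_iff power2_eq_square algebra_simps)
qed

lemma primitive_energy:
  "primitive_of (\<lambda>x. (dphi x)\<^sup>2 + (lam - x) * (phi x)\<^sup>2) (\<lambda>x. 2 * (q x * (phi x * dphi x)) - (phi x)\<^sup>2)"
proof -
  have "primitive_of (\<lambda>x. lam - x) (\<lambda>x. -1)"
    by (rule primitive_of_deriv) (auto intro!: derivative_eq_intros)
  from primitive_of_add[OF primitive_dsq primitive_of_mult[OF this primitive_sq]]
  show ?thesis
    by (rule back_subst[of "primitive_of _"]) (auto simp: fun_eq_iff algebra_simps)
qed

text \<open>Otherwise \<open>phi * dphi\<close>, half the derivative of \<open>phi\<^sup>2\<close>, would eventually exceed 1,
  contradicting square integrability.\<close>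

lemma energy_integrable_tail:
  obtains X where "0 \<le> X"
    "(\<lambda>t. (dphi t)\<^sup>2 + (t - lam) * (phi t)\<^sup>2) absolutely_integrable_on {X..}" "lam + 1 \<le> X"
proof -
  obtain X1 where X1: "X1 \<ge> 0" "\<And>x. x \<ge> X1 \<Longrightarrow> integral {x..} (\<lambda>t. \<bar>q t\<bar>) < 1/8"
    using abs_integrable_tail_small[OF q, of "1/8"] by auto
  \<comment> \<open>Beyond \<open>lam + 1\<close> the coefficient of \<open>(phi t)\<^sup>2\<close>
    in the density is at least 1, and beyond \<open>X1\<close> the remaining mass of
    \<open>\<bar>q\<bar>\<close> is below 1/8.\<close>
  define X where "X = max X1 (lam + 1)"
  have X: "0 \<le> X" "lam + 1 \<le> X" "integral {X..} (\<lambda>t. \<bar>q t\<bar>) < 1/8"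
    using X1 by (auto simp: X_def)
  define j where "j = (\<lambda>t. (dphi t)\<^sup>2 + (t - lam) * (phi t)\<^sup>2)"
  have cj: "continuous_on {X..} j"
    unfolding j_def using X cont by (intro continuous_intros) (auto elim: continuous_on_subset)
  have ij: "j integrable_on {X..y}" for y
    by (intro integrable_continuous_real continuous_on_subset[OF cj]) auto
  have j_ge: "\<bar>2 * (phi t * dphi t)\<bar> \<le> j t" "0 \<le> j t" if "t \<ge> X" for t
  proof -
    have "1 * (phi t)\<^sup>2 \<le> (t - lam) * (phi t)\<^sup>2"
      using that X by (intro mult_right_mono) auto
    moreover have "\<bar>2 * (phi t * dphi t)\<bar> \<le> (phi t)\<^sup>2 + (dphi t)\<^sup>2"
      using sum_squares_bound[of "\<bar>phi t\<bar>" "\<bar>dphi t\<bar>"] by (simp add: abs_mult)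
    ultimately show "\<bar>2 * (phi t * dphi t)\<bar> \<le> j t" by (auto simp: j_def)
    then show "0 \<le> j t" by linarith
  qed
  define J where "J y = integral {X..y} j" for y
  have J_mono: "J s \<le> J y" if "s \<le> y" for s y
    unfolding J_def using that j_ge by (intro integral_subset_le ij) auto
  have sup: "(phi s)\<^sup>2 \<le> (phi X)\<^sup>2 + J y" if "X \<le> s" "s \<le> y" for s y
  proof -
    have "\<bar>(phi s)\<^sup>2 - (phi X)\<^sup>2\<bar> \<le> integral {X..s} j"
      using that X j_ge by (intro primitive_of_bound[OF primitive_sq] ij) auto
    then show ?thesis using J_mono[of s y] that by (simp add: J_def)
  qed
  \<comment> \<open>Without \<open>q\<close>, the product would grow by exactly \<open>J y\<close>.
    By \<open>sup\<close>, the \<open>q\<close> term costs at most an eighth of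
    \<open>(phi X)\<^sup>2 + J y\<close>.\<close>
  have P_ge: "phi y * dphi y \<ge> phi X * dphi X + 7/8 * J y - 1/8 * (phi X)\<^sup>2" if y: "X \<le> y" for y
  proof -
    have hi: "((\<lambda>t. j t + q t * (phi t)\<^sup>2) has_integral (phi y * dphi y - phi X * dphi X)) {X..y}"
      using primitive_of_has_integral[OF primitive_prod X(1) y] by (simp add: j_def)
    have "((\<lambda>t. (j t + q t * (phi t)\<^sup>2) - j t) has_integral
        (phi y * dphi y - phi X * dphi X - J y)) {X..y}"
      unfolding J_def by (intro has_integral_diff hi integrable_integral ij)
    then have hq: "((\<lambda>t. q t * (phi t)\<^sup>2) has_integral (phi y * dphi y - phi X * dphi X - J y)) {X..y}"
      by simp
    have "norm (integral {X..y} (\<lambda>t. q t * (phi t)\<^sup>2))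
        \<le> integral {X..y} (\<lambda>t. ((phi X)\<^sup>2 + J y) * \<bar>q t\<bar>)"
    proof (rule integral_norm_bound_integral)
      show "(\<lambda>t. q t * (phi t)\<^sup>2) integrable_on {X..y}" using hq by blast
      show "(\<lambda>t. ((phi X)\<^sup>2 + J y) * \<bar>q t\<bar>) integrable_on {X..y}"
        by (intro integrable_on_mult_right q_interval_integrable X)
      fix t assume "t \<in> {X..y}"
      then have "(phi t)\<^sup>2 * \<bar>q t\<bar> \<le> ((phi X)\<^sup>2 + J y) * \<bar>q t\<bar>"
        using sup[of t y] by (intro mult_right_mono) auto
      then show "norm (q t * (phi t)\<^sup>2) \<le> ((phi X)\<^sup>2 + J y) * \<bar>q t\<bar>"
        by (simp add: abs_mult mult.commute)
    qed
    also have "\<dots> = ((phi X)\<^sup>2 + J y) * integral {X..y} (\<lambda>t. \<bar>q t\<bar>)"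
      by simp
    also have "\<dots> \<le> ((phi X)\<^sup>2 + J y) * (1/8)"
    proof (rule mult_left_mono)
      show "integral {X..y} (\<lambda>t. \<bar>q t\<bar>) \<le> 1/8"
        using q_interval_le_tail[OF X(1), of y] X by linarith
      show "0 \<le> (phi X)\<^sup>2 + J y" using sup[of y y] y zero_le_power2[of "phi y"] by linarith
    qed
    finally have "\<bar>phi y * dphi y - phi X * dphi X - J y\<bar> \<le> ((phi X)\<^sup>2 + J y) * (1/8)"
      using hq by (simp add: has_integral_iff)
    from abs_le_D2[OF this] show ?thesis by (simp add: field_simps)
  qed
  have "\<exists>B. \<forall>y\<ge>X. J y \<le> B"
  proof (rule ccontr)
    assume "\<not> ?thesis"
    \<comment> \<open>The threshold is the value of \<open>J y\<close> at which the lower bound in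
      \<open>P_ge\<close> reaches 1.\<close>
    then obtain y where y: "y \<ge> X" "J y > (1 - phi X * dphi X + 1/8 * (phi X)\<^sup>2) * (8/7)"
      by (meson not_le)
    have P1: "phi t * dphi t \<ge> 1" if "t \<ge> y" for t
      using P_ge[of t] J_mono[of y t] y that by auto
    have "(phi s)\<^sup>2 \<ge> 1" if "s \<ge> y + 1" for s
    proof -
      have hi: "((\<lambda>t. 2 * (phi t * dphi t)) has_integral ((phi s)\<^sup>2 - (phi y)\<^sup>2)) {y..s}"
        using y X that by (intro primitive_of_has_integral[OF primitive_sq]) auto
      have "1 * (s - y) \<le> (phi s)\<^sup>2 - (phi y)\<^sup>2"
      proof (rule has_integral_le)
        show "((\<lambda>t. 1) has_integral 1 * (s - y)) {y..s}"
          using has_integral_const_real[of "1::real" y s] that by simp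
        show "1 \<le> 2 * (phi t * dphi t)" if "t \<in> {y..s}" for t
          using P1[of t] that by auto
      qed (rule hi)
      then have "s - y + (phi y)\<^sup>2 \<le> (phi s)\<^sup>2" by simp
      moreover have "1 + 0 \<le> s - y + (phi y)\<^sup>2" using that by (intro add_mono) auto
      ultimately show ?thesis by (metis add_0_right order_trans)
    qed
    moreover obtain s where "s \<ge> y + 1" "\<bar>(phi s)\<^sup>2\<bar> < 1"
      using abs_integrable_not_bounded_below[OF phi_sq, of 1 "y + 1"] by auto
    ultimately show False by force
  qed
  then obtain B where B: "\<And>y. y \<ge> X \<Longrightarrow> J y \<le> B" by blast
  have "j absolutely_integrable_on {X..}"
    using B j_ge by (intro integrable_atLeast_if_bounded ij) (auto simp: J_def)
  then show ?thesis using that X by (auto simp: j_def)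
qed

text \<open>Beyond \<open>X\<close> both summands of the energy density are nonnegative, so it
  dominates \<open>(dphi x)\<^sup>2\<close>. Subtracting this and adding
  \<open>lam * (phi x)\<^sup>2\<close> leaves \<open>x * (phi x)\<^sup>2\<close>. The bounded
  interval up to \<open>X\<close> is covered by continuity.\<close>

lemma dphi_sq: "(\<lambda>x. (dphi x)\<^sup>2) absolutely_integrable_on {0..}"
  and x_phi_sq: "(\<lambda>x. x * (phi x)\<^sup>2) absolutely_integrable_on {0..}"
proof -
  obtain X where X: "0 \<le> X" "lam + 1 \<le> X"
    and j: "(\<lambda>t. (dphi t)\<^sup>2 + (t - lam) * (phi t)\<^sup>2) absolutely_integrable_on {X..}"
    using energy_integrable_tail by blast
  have d: "(\<lambda>x. (dphi x)\<^sup>2) absolutely_integrable_on {X..}"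
  proof (rule abs_integrable_atLeast_bound[OF _ j])
    show "continuous_on {X..} (\<lambda>x. (dphi x)\<^sup>2)"
      using X cont by (intro continuous_intros) (auto elim: continuous_on_subset)
    show "\<bar>(dphi x)\<^sup>2\<bar> \<le> (dphi x)\<^sup>2 + (x - lam) * (phi x)\<^sup>2" if "X \<le> x" for x
      using that X by auto
  qed
  have "(\<lambda>t. (dphi t)\<^sup>2 + (t - lam) * (phi t)\<^sup>2 - (dphi t)\<^sup>2 + lam * (phi t)\<^sup>2) absolutely_integrable_on {X..}"
    using abs_integrable_atLeast_mono[OF phi_sq X(1)]
    by (intro set_integral_add set_integral_diff j d) auto
  then have x: "(\<lambda>x. x * (phi x)\<^sup>2) absolutely_integrable_on {X..}"
    by (simp add: algebra_simps)
  show "(\<lambda>x. (dphi x)\<^sup>2) absolutely_integrable_on {0..}"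
    using cont X by (intro abs_integrable_atLeast_extend[OF _ d] absolutely_integrable_continuous_real continuous_intros)
      (auto elim: continuous_on_subset)
  show "(\<lambda>x. x * (phi x)\<^sup>2) absolutely_integrable_on {0..}"
    using cont X by (intro abs_integrable_atLeast_extend[OF _ x] absolutely_integrable_continuous_real continuous_intros)
      (auto elim: continuous_on_subset)
qed

lemma prod_integrable: "(\<lambda>x. phi x * dphi x) absolutely_integrable_on {0..}"
  by (intro square_integrable_product cont phi_sq dphi_sq)

lemma sq_tail: "0 \<le> x \<Longrightarrow> integral {x..} (\<lambda>t. 2 * (phi t * dphi t)) = - (phi x)\<^sup>2"
  using prod_integrable by (intro primitive_of_tail[OF primitive_sq _ phi_sq]) auto

text \<open>Since \<open>phi\<^sup>2\<close> vanishes at infinity, it is minus the tail integral of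
  its own derivative. Pointwise bounds on \<open>phi\<close> are thereby reduced to integral
  bounds.\<close>

lemma sq_le_tail:
  assumes x: "0 \<le> x" and g: "g integrable_on {x..}" "\<And>t. x \<le> t \<Longrightarrow> 2 * \<bar>phi t * dphi t\<bar> \<le> g t"
  shows "(phi x)\<^sup>2 \<le> integral {x..} g"
proof -
  have "norm (integral {x..} (\<lambda>t. 2 * (phi t * dphi t))) \<le> integral {x..} g"
    using g abs_integrable_atLeast_mono[OF prod_integrable x]
    by (intro integral_norm_bound_integral) (auto simp: set_lebesgue_integral_eq_integral abs_mult)
  then show ?thesis using sq_tail[OF x] by simp
qed

lemma phi_sq_bounded: "\<exists>B. \<forall>x\<ge>0. (phi x)\<^sup>2 \<le> B"
proof (intro exI allI impI)
  let ?g = "\<lambda>t. 2 * \<bar>phi t * dphi t\<bar>"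
  fix x :: real assume x: "0 \<le> x"
  have g: "?g absolutely_integrable_on {0..}"
    using set_integrable_abs[OF prod_integrable] by auto
  have gx: "?g integrable_on {x..}"
    using abs_integrable_atLeast_mono[OF g x] by (auto simp: set_lebesgue_integral_eq_integral)
  have "(phi x)\<^sup>2 \<le> integral {x..} ?g"
    by (rule sq_le_tail[OF x gx]) auto
  also have "\<dots> \<le> integral {0..} ?g"
    using g gx x by (intro integral_subset_le) (auto simp: set_lebesgue_integral_eq_integral)
  finally show "(phi x)\<^sup>2 \<le> integral {0..} ?g" .
qed

lemma q_phi_sq: "(\<lambda>x. q x * (phi x)\<^sup>2) absolutely_integrable_on {0..}"
proof -
  obtain B where B: "\<And>x. x \<ge> 0 \<Longrightarrow> (phi x)\<^sup>2 \<le> B" using phi_sq_bounded by blast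
  have "(\<lambda>x. (phi x)\<^sup>2 * q x) absolutely_integrable_on {0..}"
    using B cont by (intro bounded_continuous_times_abs_integrable[where B=B] q continuous_intros) auto
  then show ?thesis by (simp add: mult.commute)
qed

lemma energy_integrable: "(\<lambda>x. (dphi x)\<^sup>2 + (x - lam) * (phi x)\<^sup>2) absolutely_integrable_on {0..}"
proof -
  have "(\<lambda>x. (dphi x)\<^sup>2 + (x * (phi x)\<^sup>2 - lam * (phi x)\<^sup>2)) absolutely_integrable_on {0..}"
    using phi_sq by (intro set_integral_add set_integral_diff dphi_sq x_phi_sq) auto
  then show ?thesis by (simp add: algebra_simps)
qed

text \<open>Taken from 0, this is the quadratic form identity for the eigenvalue; taken from a point
  beyond the turning point, it controls \<open>phi * dphi\<close> there.\<close>

lemma prod_tail: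
  assumes "0 \<le> x"
  shows "integral {x..} (\<lambda>t. (dphi t)\<^sup>2 + (t - lam) * (phi t)\<^sup>2) + integral {x..} (\<lambda>t. q t * (phi t)\<^sup>2)
    = - (phi x * dphi x)"
proof -
  have "integral {x..} (\<lambda>t. ((dphi t)\<^sup>2 + (t - lam) * (phi t)\<^sup>2) + q t * (phi t)\<^sup>2) = - (phi x * dphi x)"
    by (intro primitive_of_tail[OF primitive_prod _ prod_integrable] set_integral_add
        energy_integrable q_phi_sq assms)
  moreover have "integral {x..} (\<lambda>t. ((dphi t)\<^sup>2 + (t - lam) * (phi t)\<^sup>2) + q t * (phi t)\<^sup>2)
    = integral {x..} (\<lambda>t. (dphi t)\<^sup>2 + (t - lam) * (phi t)\<^sup>2) + integral {x..} (\<lambda>t. q t * (phi t)\<^sup>2)"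
    using abs_integrable_atLeast_mono[OF energy_integrable assms] abs_integrable_atLeast_mono[OF q_phi_sq assms]
    by (intro Henstock_Kurzweil_Integration.integral_add) (auto simp: set_lebesgue_integral_eq_integral)
  ultimately show ?thesis by simp
qed

text \<open>The factor \<open>phi * dphi\<close> is bounded because, up to sign, it is a tail
  integral of an integrable function.\<close>

lemma q_prod_integrable: "(\<lambda>x. q x * (phi x * dphi x)) absolutely_integrable_on {0..}"
proof -
  define g where "g = (\<lambda>t. ((dphi t)\<^sup>2 + (t - lam) * (phi t)\<^sup>2) + q t * (phi t)\<^sup>2)"
  have g: "g absolutely_integrable_on {0..}"
    unfolding g_def by (intro set_integral_add energy_integrable q_phi_sq)
  have B: "\<bar>phi x * dphi x\<bar> \<le> integral {0..} (\<lambda>t. \<bar>g t\<bar>)" if x: "0 \<le> x" for x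
  proof -
    have gx: "g absolutely_integrable_on {x..}"
      using abs_integrable_atLeast_mono[OF g x] .
    have "integral {x..} g = - (phi x * dphi x)"
      unfolding g_def
      by (intro primitive_of_tail[OF primitive_prod _ prod_integrable] set_integral_add
          energy_integrable q_phi_sq x)
    then have "\<bar>phi x * dphi x\<bar> = norm (integral {x..} g)" by simp
    also have "\<dots> \<le> integral {x..} (\<lambda>t. \<bar>g t\<bar>)"
      using gx by (intro integral_norm_bound_integral) (auto simp: absolutely_integrable_on_def)
    also have "\<dots> \<le> integral {0..} (\<lambda>t. \<bar>g t\<bar>)"
      using gx g x by (intro integral_subset_le) (auto simp: absolutely_integrable_on_def)
    finally show ?thesis .
  qed
  have "(\<lambda>x. (phi x * dphi x) * q x) absolutely_integrable_on {0..}"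
    by (intro bounded_continuous_times_abs_integrable[OF _ B q] continuous_intros cont)
  then show ?thesis by (simp add: mult.commute)
qed

lemma norm_identity:
  "integral {0..} (\<lambda>x. (phi x)\<^sup>2) = (dphi 0)\<^sup>2 + 2 * integral {0..} (\<lambda>x. q x * (phi x * dphi x))"
proof -
  have "(\<lambda>x. (dphi x)\<^sup>2 + (lam * (phi x)\<^sup>2 - x * (phi x)\<^sup>2)) absolutely_integrable_on {0..}"
    using phi_sq by (intro set_integral_add set_integral_diff dphi_sq x_phi_sq) auto
  then have E: "(\<lambda>x. (dphi x)\<^sup>2 + (lam - x) * (phi x)\<^sup>2) absolutely_integrable_on {0..}"
    by (simp add: algebra_simps)
  have "(\<lambda>x. 2 * (q x * (phi x * dphi x)) - (phi x)\<^sup>2) absolutely_integrable_on {0..}"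
    using q_prod_integrable by (intro set_integral_diff phi_sq) auto
  from primitive_of_tail[OF primitive_energy this E, of 0]
  have "integral {0..} (\<lambda>x. 2 * (q x * (phi x * dphi x)) - (phi x)\<^sup>2) = - (dphi 0)\<^sup>2"
    by (simp add: phi0)
  moreover have "integral {0..} (\<lambda>x. 2 * (q x * (phi x * dphi x)) - (phi x)\<^sup>2)
    = integral {0..} (\<lambda>x. 2 * (q x * (phi x * dphi x))) - integral {0..} (\<lambda>x. (phi x)\<^sup>2)"
    using q_prod_integrable phi_sq
    by (intro Henstock_Kurzweil_Integration.integral_diff) (auto simp: set_lebesgue_integral_eq_integral)
  ultimately show ?thesis by simp
qed

end

section \<open>The product of eigenfunction and derivative at large energy\<close>

lemma primitive_of_upper:
  assumes F: "primitive_of F f" and x: "0 \<le> x" "x \<le> y"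
    and g: "g integrable_on {x..y}" "\<And>t. x \<le> t \<Longrightarrow> t \<le> y \<Longrightarrow> f t \<le> g t"
  shows "F y \<le> F x + integral {x..y} g"
proof -
  have "integral {x..y} f \<le> integral {x..y} g"
    using primitive_of_has_integral[OF F x] g by (intro integral_le) (auto simp: has_integral_iff)
  then show ?thesis
    using primitive_of_has_integral[OF F x] by (simp add: has_integral_iff)
qed

text \<open>Converts energy bounds into bounds on \<open>phi * dphi\<close>: \<open>m\<close> is the
  coefficient of \<open>(phi x)\<^sup>2\<close> in the energy and \<open>s\<close> a lower bound for
  its square root.\<close>

lemma weighted_am_gm:
  fixes d p s m :: real
  assumes "0 \<le> s" "s\<^sup>2 \<le> m"
  shows "2 * \<bar>p * d\<bar> * s \<le> d\<^sup>2 + m * p\<^sup>2"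
proof -
  have "2 * \<bar>d\<bar> * (s * \<bar>p\<bar>) \<le> \<bar>d\<bar>\<^sup>2 + (s * \<bar>p\<bar>)\<^sup>2"
    by (rule sum_squares_bound)
  also have "\<dots> \<le> d\<^sup>2 + m * p\<^sup>2"
    using assms by (simp add: power_mult_distrib mult_right_mono)
  finally show ?thesis by (simp add: abs_mult mult_ac)
qed

text \<open>A Gronwall estimate for small kernels: at a maximum point of \<open>f\<close>, the factor 1/2 is absorbed.\<close>

lemma absorb_half_bound:
  fixes f :: "real \<Rightarrow> real"
  assumes "a \<le> b" "continuous_on {a..b} f" "x \<in> {a..b}"
    and step: "\<And>S y. (\<And>t. t \<in> {a..b} \<Longrightarrow> f t \<le> S) \<Longrightarrow> y \<in> {a..b} \<Longrightarrow> f y \<le> A + S / 2"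
  shows "f x \<le> 2 * A"
proof -
  obtain y where y: "y \<in> {a..b}" "\<And>t. t \<in> {a..b} \<Longrightarrow> f t \<le> f y"
    using continuous_attains_sup[of "{a..b}" f] assms by auto
  have "f y \<le> A + f y / 2" using step[of "f y" y] y by auto
  with y(2)[OF assms(3)] show ?thesis by simp
qed

context stark_solution
begin

text \<open>The thresholds let each \<open>q\<close> term be absorbed: with \<open>S\<close> a bound
  for the energy, it costs \<open>S / 4\<close> on \<open>{0..lam / 2}\<close> and
  \<open>4 * S / 64\<close> on later intervals. The bound \<open>lam \<ge> 2\<close> places
  \<open>lam / 2\<close> to the left of \<open>lam - 1/16\<close>.\<close>

context
  assumes lam: "lam \<ge> 2"
    and small_total: "integral {0..} (\<lambda>t. \<bar>q t\<bar>) \<le> sqrt (lam / 2) / 4"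
    and small_tail: "integral {lam / 2..} (\<lambda>t. \<bar>q t\<bar>) \<le> 1 / 64"
begin

lemma energy_oscillatory:
  assumes x: "0 \<le> x" "x \<le> lam - 1/16"
  shows "(dphi x)\<^sup>2 + (lam - x) * (phi x)\<^sup>2 \<le> 2 * (dphi 0)\<^sup>2"
proof (rule absorb_half_bound[of 0 "lam - 1/16" "\<lambda>x. (dphi x)\<^sup>2 + (lam - x) * (phi x)\<^sup>2"])
  show "0 \<le> lam - 1/16" using lam by simp
  show "continuous_on {0..lam - 1/16} (\<lambda>x. (dphi x)\<^sup>2 + (lam - x) * (phi x)\<^sup>2)"
    using primitive_of_continuous[OF primitive_energy] by (rule continuous_on_subset) auto
  show "x \<in> {0..lam - 1/16}" using x by simp
  define E where "E = (\<lambda>x. (dphi x)\<^sup>2 + (lam - x) * (phi x)\<^sup>2)"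
  fix S y assume S: "\<And>t. t \<in> {0..lam - 1/16} \<Longrightarrow> (dphi t)\<^sup>2 + (lam - t) * (phi t)\<^sup>2 \<le> S"
    and y: "y \<in> {0..lam - 1/16}"
  have S0: "0 \<le> S" using S[of 0] lam phi0 order_trans[OF zero_le_power2[of "dphi 0"]] by simp
  have r: "sqrt (lam / 2) > 0" using lam by simp
  note q_int = integrable_on_mult_right[OF q_interval_integrable]
  \<comment> \<open>Up to \<open>lam / 2\<close> the coefficient \<open>lam - t\<close> is at least
    \<open>lam / 2\<close>, so the total mass of \<open>\<bar>q\<bar>\<close> is weighted by
    \<open>S / sqrt (lam / 2)\<close>. The term \<open>- (phi t)\<^sup>2\<close> of the derivative
    is dropped by its sign.\<close>
  have first: "E z \<le> (dphi 0)\<^sup>2 + S / 4" if z: "0 \<le> z" "z \<le> lam / 2" for z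
  proof -
    have "E z \<le> E 0 + integral {0..z} (\<lambda>t. S / sqrt (lam / 2) * \<bar>q t\<bar>)"
      unfolding E_def
    proof (rule primitive_of_upper[OF primitive_energy _ z(1)])
      fix t assume t: "0 \<le> t" "t \<le> z"
      have "2 * \<bar>phi t * dphi t\<bar> * sqrt (lam / 2) \<le> (dphi t)\<^sup>2 + (lam - t) * (phi t)\<^sup>2"
        using t z lam by (intro weighted_am_gm) auto
      also have "\<dots> \<le> S" using t z lam by (intro S) auto
      finally have "2 * \<bar>phi t * dphi t\<bar> \<le> S / sqrt (lam / 2)" using r by (simp add: field_simps)
      then have "2 * \<bar>phi t * dphi t\<bar> * \<bar>q t\<bar> \<le> S / sqrt (lam / 2) * \<bar>q t\<bar>"
        by (rule mult_right_mono) auto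
      moreover have "2 * (q t * (phi t * dphi t)) \<le> 2 * \<bar>phi t * dphi t\<bar> * \<bar>q t\<bar>"
        using abs_ge_self[of "q t * (phi t * dphi t)"] by (simp add: abs_mult mult_ac)
      ultimately show "2 * (q t * (phi t * dphi t)) - (phi t)\<^sup>2 \<le> S / sqrt (lam / 2) * \<bar>q t\<bar>"
        using zero_le_power2[of "phi t"] by linarith
    next
      show "(\<lambda>t. S / sqrt (lam / 2) * \<bar>q t\<bar>) integrable_on {0..z}"
        by (rule q_int) simp
    qed simp
    also have "\<dots> = (dphi 0)\<^sup>2 + S / sqrt (lam / 2) * integral {0..z} (\<lambda>t. \<bar>q t\<bar>)"
      by (simp add: E_def phi0)
    also have "\<dots> \<le> (dphi 0)\<^sup>2 + S / sqrt (lam / 2) * (sqrt (lam / 2) / 4)"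
      using q_interval_le_tail[of 0 z] small_total S0 r
      by (intro add_left_mono mult_left_mono) auto
    also have "\<dots> = (dphi 0)\<^sup>2 + S / 4" using r by simp
    finally show ?thesis .
  qed
  have "E y \<le> (dphi 0)\<^sup>2 + S / 2"
  proof (cases "y \<le> lam / 2")
    case True
    then show ?thesis using first[of y] y S0 by auto
  next
    case False
    \<comment> \<open>Past \<open>lam / 2\<close> the coefficient is known to be at least 1/16, with
      root 1/4; the weaker weight \<open>4 * S\<close> is compensated by the small tail of
      \<open>\<bar>q\<bar>\<close>.\<close>
    have "E y \<le> E (lam / 2) + integral {lam / 2..y} (\<lambda>t. (4 * S) * \<bar>q t\<bar>)"
      unfolding E_def
    proof (rule primitive_of_upper[OF primitive_energy])
      fix t assume t: "lam / 2 \<le> t" "t \<le> y"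
      have "2 * \<bar>phi t * dphi t\<bar> * (1/4) \<le> (dphi t)\<^sup>2 + (lam - t) * (phi t)\<^sup>2"
        using t y lam by (intro weighted_am_gm) (auto simp: power2_eq_square)
      also have "\<dots> \<le> S" using t y lam by (intro S) auto
      finally have "2 * \<bar>phi t * dphi t\<bar> \<le> 4 * S" by simp
      then have "2 * \<bar>phi t * dphi t\<bar> * \<bar>q t\<bar> \<le> (4 * S) * \<bar>q t\<bar>"
        by (rule mult_right_mono) auto
      moreover have "2 * (q t * (phi t * dphi t)) \<le> 2 * \<bar>phi t * dphi t\<bar> * \<bar>q t\<bar>"
        using abs_ge_self[of "q t * (phi t * dphi t)"] by (simp add: abs_mult mult_ac)
      ultimately show "2 * (q t * (phi t * dphi t)) - (phi t)\<^sup>2 \<le> (4 * S) * \<bar>q t\<bar>"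
        using zero_le_power2[of "phi t"] by linarith
    next
      show "(\<lambda>t. (4 * S) * \<bar>q t\<bar>) integrable_on {lam / 2..y}"
        using lam by (intro q_int) simp
    qed (use False lam in auto)
    also have "\<dots> = E (lam / 2) + (4 * S) * integral {lam / 2..y} (\<lambda>t. \<bar>q t\<bar>)" by simp
    also have "\<dots> \<le> E (lam / 2) + (4 * S) * (1 / 64)"
      using q_interval_le_tail[of "lam / 2" y] small_tail S0 lam
      by (intro add_left_mono mult_left_mono) auto
    also have "\<dots> \<le> (dphi 0)\<^sup>2 + S / 2" using first[of "lam / 2"] lam S0 by simp
    finally show ?thesis .
  qed
  then show "(dphi y)\<^sup>2 + (lam - y) * (phi y)\<^sup>2 \<le> (dphi 0)\<^sup>2 + S / 2" by (simp add: E_def)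
qed

text \<open>Freezing the coefficient of \<open>phi\<^sup>2\<close> at 1/16 avoids its zero at
  \<open>lam\<close> and agrees with the previous energy at \<open>lam - 1/16\<close>. The
  derivative becomes \<open>t - lam + 1/16 + q t\<close> times \<open>2 * (phi t * dphi t)\<close>,
  where \<open>t - lam + 1/16\<close> lies between 0 and 1/8 on an interval of length 1/8.\<close>

lemma energy_turning:
  assumes x: "lam - 1/16 \<le> x" "x \<le> lam + 1/16"
  shows "(dphi x)\<^sup>2 + 1/16 * (phi x)\<^sup>2 \<le> 4 * (dphi 0)\<^sup>2"
proof -
  have prim: "primitive_of (\<lambda>x. (dphi x)\<^sup>2 + 1/16 * (phi x)\<^sup>2)
     (\<lambda>x. 2 * (x + q x - lam) * (phi x * dphi x) + 1/16 * (2 * (phi x * dphi x)))"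
    by (intro primitive_of_add primitive_of_cmult primitive_dsq primitive_sq)
  have "(dphi x)\<^sup>2 + 1/16 * (phi x)\<^sup>2 \<le> 2 * ((dphi (lam - 1/16))\<^sup>2 + 1/16 * (phi (lam - 1/16))\<^sup>2)"
  proof (rule absorb_half_bound[of "lam - 1/16" "lam + 1/16" "\<lambda>x. (dphi x)\<^sup>2 + 1/16 * (phi x)\<^sup>2"])
    show "continuous_on {lam - 1/16..lam + 1/16} (\<lambda>x. (dphi x)\<^sup>2 + 1/16 * (phi x)\<^sup>2)"
      using primitive_of_continuous[OF prim] lam by (elim continuous_on_subset) auto
    show "x \<in> {lam - 1/16..lam + 1/16}" using x by simp
    fix S y assume S: "\<And>t. t \<in> {lam - 1/16..lam + 1/16} \<Longrightarrow> (dphi t)\<^sup>2 + 1/16 * (phi t)\<^sup>2 \<le> S"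
      and y: "y \<in> {lam - 1/16..lam + 1/16}"
    have S0: "0 \<le> S" using S[OF y] zero_le_power2[of "dphi y"] zero_le_power2[of "phi y"] by linarith
    have hi: "((\<lambda>t. S / 2 + (4 * S) * \<bar>q t\<bar>) has_integral
       (S / 2 * (y - (lam - 1/16)) + (4 * S) * integral {lam - 1/16..y} (\<lambda>t. \<bar>q t\<bar>))) {lam - 1/16..y}"
      using y lam has_integral_const_real[of "S / 2" "lam - 1/16" y]
      by (intro has_integral_add has_integral_mult_right integrable_integral q_interval_integrable)
        (auto simp: mult.commute)
    have "(dphi y)\<^sup>2 + 1/16 * (phi y)\<^sup>2 \<le> ((dphi (lam - 1/16))\<^sup>2 + 1/16 * (phi (lam - 1/16))\<^sup>2)
      + integral {lam - 1/16..y} (\<lambda>t. S / 2 + (4 * S) * \<bar>q t\<bar>)"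
    proof (rule primitive_of_upper[OF prim])
      fix t assume t: "lam - 1/16 \<le> t" "t \<le> y"
      have "2 * \<bar>phi t * dphi t\<bar> * (1/4) \<le> (dphi t)\<^sup>2 + 1/16 * (phi t)\<^sup>2"
        by (intro weighted_am_gm) (auto simp: power2_eq_square)
      also have "\<dots> \<le> S" using t y by (intro S) auto
      finally have P: "2 * \<bar>phi t * dphi t\<bar> \<le> 4 * S" by simp
      have "2 * (t + q t - lam) * (phi t * dphi t) + 1/16 * (2 * (phi t * dphi t))
        = (t - lam + 1/16 + q t) * (2 * (phi t * dphi t))" by (simp add: algebra_simps)
      also have "\<dots> \<le> \<bar>t - lam + 1/16 + q t\<bar> * (2 * \<bar>phi t * dphi t\<bar>)"
        using abs_ge_self[of "(t - lam + 1/16 + q t) * (2 * (phi t * dphi t))"]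
        by (simp only: abs_mult abs_numeral)
      also have "\<dots> \<le> (1/8 + \<bar>q t\<bar>) * (4 * S)"
        by (rule mult_mono[OF _ P]) (use t y in auto)
      finally show "2 * (t + q t - lam) * (phi t * dphi t) + 1/16 * (2 * (phi t * dphi t))
        \<le> S / 2 + (4 * S) * \<bar>q t\<bar>" by (simp add: algebra_simps)
    qed (use hi y lam in auto)
    also have "integral {lam - 1/16..y} (\<lambda>t. S / 2 + (4 * S) * \<bar>q t\<bar>)
      = S / 2 * (y - (lam - 1/16)) + (4 * S) * integral {lam - 1/16..y} (\<lambda>t. \<bar>q t\<bar>)"
      using hi by (simp add: has_integral_iff)
    also have "\<dots> \<le> S / 2 * (1/8) + (4 * S) * (1/64)"
    proof (intro add_mono mult_left_mono)
      have "integral {lam - 1/16..y} (\<lambda>t. \<bar>q t\<bar>) \<le> integral {lam / 2..} (\<lambda>t. \<bar>q t\<bar>)"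
        using y lam by (intro integral_subset_le q_interval_integrable q_tail_integrable) auto
      then show "integral {lam - 1/16..y} (\<lambda>t. \<bar>q t\<bar>) \<le> 1/64" using small_tail by simp
    qed (use y S0 in auto)
    finally show "(dphi y)\<^sup>2 + 1/16 * (phi y)\<^sup>2
      \<le> ((dphi (lam - 1/16))\<^sup>2 + 1/16 * (phi (lam - 1/16))\<^sup>2) + S / 2" using S0 by simp
  qed auto
  also have "\<dots> \<le> 2 * (2 * (dphi 0)\<^sup>2)"
    using energy_oscillatory[of "lam - 1/16"] lam by simp
  finally show ?thesis by simp
qed

text \<open>Beyond the turning point \<open>j\<close> is nonnegative, and its total integral
  \<open>R\<close> dominates \<open>phi\<^sup>2\<close> and hence the \<open>q\<close> term. The
  identity \<open>prod_tail\<close> at \<open>b\<close> bounds \<open>R\<close> by the value of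
  \<open>phi * dphi\<close> at \<open>b\<close>; the same identity at \<open>x\<close> then bounds
  the product by \<open>R\<close>, up to the \<open>q\<close> term.\<close>

lemma product_forbidden:
  assumes x: "lam + 1/16 \<le> x"
  shows "\<bar>phi x * dphi x\<bar> \<le> 32 * (dphi 0)\<^sup>2"
proof -
  define b where "b = lam + 1/16"
  define j where "j = (\<lambda>t. (dphi t)\<^sup>2 + (t - lam) * (phi t)\<^sup>2)"
  define R where "R = integral {b..} j"
  have b: "0 \<le> b" "lam / 2 \<le> b" using lam by (auto simp: b_def)
  have j_int: "j integrable_on {y..}" if "y \<ge> b" for y
    using abs_integrable_atLeast_mono[OF energy_integrable, of y] that b
    by (auto simp: j_def set_lebesgue_integral_eq_integral)
  have qp_int: "(\<lambda>t. q t * (phi t)\<^sup>2) integrable_on {y..}" if "y \<ge> b" for y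
    using abs_integrable_atLeast_mono[OF q_phi_sq, of y] that b
    by (auto simp: set_lebesgue_integral_eq_integral)
  have j0: "0 \<le> j t" if "t \<ge> b" for t using that by (auto simp: j_def b_def)
  have Ry: "integral {y..} j \<le> R" if "y \<ge> b" for y
    unfolding R_def using that j0 by (intro integral_subset_le j_int) auto
  have R0: "0 \<le> R" unfolding R_def using j0 by (intro integral_nonneg j_int) auto
  have sup: "(phi y)\<^sup>2 \<le> 4 * R" if y: "y \<ge> b" for y
  proof -
    have "(phi y)\<^sup>2 \<le> integral {y..} (\<lambda>t. 4 * j t)"
    proof (rule sq_le_tail)
      show "(\<lambda>t. 4 * j t) integrable_on {y..}"
        by (intro integrable_on_mult_right j_int y)
      fix t assume t: "y \<le> t"
      have "2 * \<bar>phi t * dphi t\<bar> * (1/4) \<le> j t"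
        unfolding j_def using t y by (intro weighted_am_gm) (auto simp: power2_eq_square b_def)
      then show "2 * \<bar>phi t * dphi t\<bar> \<le> 4 * j t" by simp
    qed (use y b in auto)
    then show ?thesis using Ry[OF y] by simp
  qed
  have qp: "\<bar>integral {y..} (\<lambda>t. q t * (phi t)\<^sup>2)\<bar> \<le> R / 16" if y: "y \<ge> b" for y
  proof -
    have "norm (integral {y..} (\<lambda>t. q t * (phi t)\<^sup>2)) \<le> integral {y..} (\<lambda>t. 4 * R * \<bar>q t\<bar>)"
    proof (rule integral_norm_bound_integral)
      show "(\<lambda>t. 4 * R * \<bar>q t\<bar>) integrable_on {y..}"
        using y b by (intro integrable_on_mult_right q_tail_integrable) auto
      fix t assume "t \<in> {y..}"
      then have "(phi t)\<^sup>2 * \<bar>q t\<bar> \<le> 4 * R * \<bar>q t\<bar>" using sup[of t] y by (intro mult_right_mono) auto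
      then show "norm (q t * (phi t)\<^sup>2) \<le> 4 * R * \<bar>q t\<bar>" by (simp add: abs_mult mult_ac)
    qed (use qp_int y in auto)
    also have "\<dots> = 4 * R * integral {y..} (\<lambda>t. \<bar>q t\<bar>)" by simp
    also have "\<dots> \<le> 4 * R * integral {lam / 2..} (\<lambda>t. \<bar>q t\<bar>)"
      using R0 y b lam by (intro mult_left_mono integral_subset_le q_tail_integrable) auto
    also have "\<dots> \<le> 4 * R * (1/64)" using R0 small_tail by (intro mult_left_mono) auto
    finally show ?thesis by simp
  qed
  have "2 * \<bar>phi b * dphi b\<bar> * (1/4) \<le> (dphi b)\<^sup>2 + 1/16 * (phi b)\<^sup>2"
    by (intro weighted_am_gm) (auto simp: power2_eq_square)
  then have "\<bar>phi b * dphi b\<bar> \<le> 8 * (dphi 0)\<^sup>2"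
    using energy_turning[of b] by (simp add: b_def)
  moreover have "R + integral {b..} (\<lambda>t. q t * (phi t)\<^sup>2) = - (phi b * dphi b)"
    unfolding R_def j_def by (rule prod_tail[OF b(1)])
  \<comment> \<open>The \<open>q\<close> term is at most \<open>R / 16\<close>, so
    \<open>15/16 * R\<close> is at most \<open>8 * (dphi 0)\<^sup>2\<close>.\<close>
  ultimately have "R \<le> 16 * (dphi 0)\<^sup>2" using qp[of b] R0 by linarith
  moreover have "integral {x..} j + integral {x..} (\<lambda>t. q t * (phi t)\<^sup>2) = - (phi x * dphi x)"
    unfolding j_def using x lam by (intro prod_tail) auto
  moreover have "0 \<le> integral {x..} j" using j0 x by (intro integral_nonneg j_int) (auto simp: b_def)
  moreover have "x \<ge> b" using x by (simp add: b_def)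
  ultimately show ?thesis using qp[of x] Ry[of x] by linarith
qed

lemma product_left: "0 \<le> x \<Longrightarrow> x \<le> lam / 2 \<Longrightarrow> \<bar>phi x * dphi x\<bar> \<le> (dphi 0)\<^sup>2 / sqrt (lam / 2)"
proof -
  assume x: "0 \<le> x" "x \<le> lam / 2"
  have "2 * \<bar>phi x * dphi x\<bar> * sqrt (lam / 2) \<le> (dphi x)\<^sup>2 + (lam - x) * (phi x)\<^sup>2"
    using x lam by (intro weighted_am_gm) auto
  also have "\<dots> \<le> 2 * (dphi 0)\<^sup>2" using x lam by (intro energy_oscillatory) auto
  finally show ?thesis using lam by (simp add: field_simps)
qed

lemma product_right:
  assumes "lam / 2 \<le> x"
  shows "\<bar>phi x * dphi x\<bar> \<le> 32 * (dphi 0)\<^sup>2"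
proof -
  consider "x \<le> lam - 1/16" | "lam - 1/16 \<le> x" "x \<le> lam + 1/16" | "lam + 1/16 \<le> x" by linarith
  then show ?thesis
  proof cases
    case 1
    have "2 * \<bar>phi x * dphi x\<bar> * (1/4) \<le> (dphi x)\<^sup>2 + (lam - x) * (phi x)\<^sup>2"
      using 1 by (intro weighted_am_gm) (auto simp: power2_eq_square)
    then show ?thesis
      using energy_oscillatory[of x] 1 assms lam zero_le_power2[of "dphi 0"] by linarith
  next
    case 2
    have "2 * \<bar>phi x * dphi x\<bar> * (1/4) \<le> (dphi x)\<^sup>2 + 1/16 * (phi x)\<^sup>2"
      by (intro weighted_am_gm) (auto simp: power2_eq_square)
    then show ?thesis
      using energy_turning[of x] 2 zero_le_power2[of "dphi 0"] by linarith
  next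
    case 3
    then show ?thesis by (rule product_forbidden)
  qed
qed

lemma norm_deviation:
  "\<bar>integral {0..} (\<lambda>x. (phi x)\<^sup>2) - (dphi 0)\<^sup>2\<bar>
    \<le> 2 * (dphi 0)\<^sup>2 * (integral {0..} (\<lambda>t. \<bar>q t\<bar>) / sqrt (lam / 2) + 32 * integral {lam / 2..} (\<lambda>t. \<bar>q t\<bar>))"
proof -
  let ?f = "\<lambda>x. q x * (phi x * dphi x)"
  have r: "sqrt (lam / 2) > 0" using lam by simp
  have bound: "norm (integral A ?f) \<le> c * integral A (\<lambda>t. \<bar>q t\<bar>)"
    if "?f integrable_on A" "(\<lambda>t. \<bar>q t\<bar>) integrable_on A" "\<And>t. t \<in> A \<Longrightarrow> \<bar>phi t * dphi t\<bar> \<le> c" for A c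
  proof -
    have "norm (integral A ?f) \<le> integral A (\<lambda>t. c * \<bar>q t\<bar>)"
    proof (rule integral_norm_bound_integral)
      fix t assume "t \<in> A"
      then have "\<bar>phi t * dphi t\<bar> * \<bar>q t\<bar> \<le> c * \<bar>q t\<bar>" using that by (intro mult_right_mono) auto
      then show "norm (?f t) \<le> c * \<bar>q t\<bar>" by (simp add: abs_mult mult_ac)
    qed (intro that integrable_on_mult_right)+
    then show ?thesis by simp
  qed
  have "integral {0..} ?f = integral {0..lam / 2} ?f + integral {lam / 2..} ?f"
    using lam by (intro integral_atLeast_split q_prod_integrable) auto
  moreover have "norm (integral {0..lam / 2} ?f) \<le> (dphi 0)\<^sup>2 / sqrt (lam / 2) * integral {0..lam / 2} (\<lambda>t. \<bar>q t\<bar>)"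
    using q_prod_integrable
    by (intro bound q_interval_integrable product_left)
       (auto intro!: set_lebesgue_integral_eq_integral(1) intro: set_integrable_subset)
  moreover have "(dphi 0)\<^sup>2 / sqrt (lam / 2) * integral {0..lam / 2} (\<lambda>t. \<bar>q t\<bar>)
      \<le> (dphi 0)\<^sup>2 / sqrt (lam / 2) * integral {0..} (\<lambda>t. \<bar>q t\<bar>)"
    using r by (intro mult_left_mono q_interval_le_tail) auto
  moreover have "norm (integral {lam / 2..} ?f) \<le> 32 * (dphi 0)\<^sup>2 * integral {lam / 2..} (\<lambda>t. \<bar>q t\<bar>)"
    using abs_integrable_atLeast_mono[OF q_prod_integrable, of "lam / 2"] lam
    by (intro bound q_tail_integrable product_right) (auto simp: set_lebesgue_integral_eq_integral)
  ultimately show ?thesis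
    unfolding norm_identity by (simp add: abs_le_iff algebra_simps)
qed

end

lemma phi_sq_integral_pos: "0 < integral {0..} (\<lambda>x. (phi x)\<^sup>2)"
proof (rule ccontr)
  assume "\<not> ?thesis"
  moreover have "0 \<le> integral {0..} (\<lambda>x. (phi x)\<^sup>2)"
    using phi_sq by (intro integral_nonneg) (auto simp: set_lebesgue_integral_eq_integral)
  ultimately have 0: "integral {0..} (\<lambda>x. (phi x)\<^sup>2) = 0" by simp
  obtain x where x: "x \<ge> 0" "phi x \<noteq> 0" using nontrivial by blast
  \<comment> \<open>Ending at \<open>x + 1\<close> keeps the interval nondegenerate even for
    \<open>x = 0\<close>.\<close>
  have "integral {0..x+1} (\<lambda>x. (phi x)\<^sup>2) \<le> integral {0..} (\<lambda>x. (phi x)\<^sup>2)"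
    using phi_sq
    by (intro integral_subset_le)
      (auto intro!: set_lebesgue_integral_eq_integral(1) intro: set_integrable_subset)
  moreover have c: "continuous_on {0..x+1} (\<lambda>x. (phi x)\<^sup>2)"
    using cont by (intro continuous_intros) (auto elim: continuous_on_subset)
  moreover have "0 \<le> integral {0..x+1} (\<lambda>x. (phi x)\<^sup>2)"
    using c by (intro integral_nonneg integrable_continuous_real) auto
  ultimately have "((\<lambda>x. (phi x)\<^sup>2) has_integral 0) (cbox 0 (x+1))"
    using 0 integrable_continuous_real[OF c] by (simp add: has_integral_iff)
  from has_integral_0_cbox_imp_0[OF _ _ this, of x] c x show False by auto
qed

end

section \<open>Absence of finite accumulation points of eigenvalues\<close>

text \<open>The Wronskian of the two eigenfunctions has derivative
  \<open>(lam - mu) * (phi x * psi x)\<close>; it vanishes at 0 by the Dirichlet condition and at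
  infinity by integrability.\<close>

lemma eigenfunctions_orthogonal:
  assumes "stark_solution q lam phi dphi" "stark_solution q mu psi dpsi" and ne: "lam \<noteq> mu"
  shows "integral {0..} (\<lambda>x. phi x * psi x) = 0"
proof -
  interpret a: stark_solution q lam phi dphi by fact
  interpret b: stark_solution q mu psi dpsi by fact
  have "primitive_of (\<lambda>x. phi x * dpsi x - psi x * dphi x) (\<lambda>x. (lam - mu) * (phi x * psi x))"
    using primitive_of_diff[OF primitive_of_mult[OF a.phi b.dphi] primitive_of_mult[OF b.phi a.dphi]]
    by (rule back_subst[of "primitive_of _"]) (auto simp: fun_eq_iff algebra_simps)
  moreover have "(\<lambda>x. (lam - mu) * (phi x * psi x)) absolutely_integrable_on {0..}"
    using square_integrable_product[OF a.cont(1) b.cont(1) a.phi_sq b.phi_sq] by auto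
  moreover have "(\<lambda>x. phi x * dpsi x - psi x * dphi x) absolutely_integrable_on {0..}"
    by (intro set_integral_diff square_integrable_product a.cont b.cont a.phi_sq b.phi_sq
        a.dphi_sq b.dphi_sq)
  ultimately have "integral {0..} (\<lambda>x. (lam - mu) * (phi x * psi x)) = - (phi 0 * dpsi 0 - psi 0 * dphi 0)"
    by (rule primitive_of_tail) simp
  then show ?thesis using ne by (simp add: a.phi0 b.phi0)
qed

section \<open>Bounds on an eigenfunction in terms of its eigenvalue and norm\<close>

context stark_solution
begin

lemma scaled:
  assumes "c \<noteq> 0"
  shows "stark_solution q lam (\<lambda>x. c * phi x) (\<lambda>x. c * dphi x)"
proof
  show "primitive_of (\<lambda>x. c * dphi x) (\<lambda>t. (t + q t - lam) * (c * phi t))"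
    using primitive_of_cmult[OF dphi, of c] by (simp add: mult_ac)
qed (use q phi phi0 phi_sq nontrivial assms primitive_of_cmult in \<open>auto simp: power_mult_distrib\<close>)

text \<open>The free parameter \<open>s\<close> allows the share of the kinetic term to be made as
  small as desired, which is how the \<open>q\<close> term is absorbed in
  \<open>energy_bound\<close>.\<close>

lemma sup_bound:
  assumes x: "0 \<le> x" and s: "0 < s"
  shows "(phi x)\<^sup>2 \<le> integral {0..} (\<lambda>t. (dphi t)\<^sup>2) / s + s * integral {0..} (\<lambda>t. (phi t)\<^sup>2)"
proof -
  define g where "g = (\<lambda>t. (dphi t)\<^sup>2 / s + s * (phi t)\<^sup>2)"
  have g: "g absolutely_integrable_on {0..}"
    unfolding g_def using dphi_sq phi_sq by (intro set_integral_add) auto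
  have gx: "g integrable_on {y..}" if "0 \<le> y" for y
    using abs_integrable_atLeast_mono[OF g that] by (simp add: set_lebesgue_integral_eq_integral)
  have "(phi x)\<^sup>2 \<le> integral {x..} g"
  proof (rule sq_le_tail[OF x gx[OF x]])
    fix t
    have "2 * \<bar>phi t * dphi t\<bar> * s \<le> (dphi t)\<^sup>2 + s\<^sup>2 * (phi t)\<^sup>2"
      using s by (intro weighted_am_gm) auto
    then show "2 * \<bar>phi t * dphi t\<bar> \<le> g t"
      using s by (simp add: g_def field_simps power2_eq_square)
  qed
  also have "\<dots> \<le> integral {0..} g"
    using x s by (intro integral_subset_le gx) (auto simp: g_def)
  also have "\<dots> = integral {0..} (\<lambda>t. (dphi t)\<^sup>2 / s) + integral {0..} (\<lambda>t. s * (phi t)\<^sup>2)"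
    unfolding g_def using dphi_sq phi_sq
    by (intro Henstock_Kurzweil_Integration.integral_add) (auto simp: set_lebesgue_integral_eq_integral)
  finally show ?thesis by simp
qed

text \<open>The identity \<open>prod_tail\<close> at 0 reads \<open>T + V + integral {0..}
  (\<lambda>t. q t * (phi t)\<^sup>2) = lam * N\<close>. Bounding \<open>(phi t)\<^sup>2\<close>
  uniformly, the \<open>q\<close> term uses up at most half of \<open>T\<close>.\<close>

lemma energy_bound:
  "integral {0..} (\<lambda>t. (dphi t)\<^sup>2) / 2 + integral {0..} (\<lambda>t. t * (phi t)\<^sup>2)
    \<le> (lam + 2 * (integral {0..} (\<lambda>t. \<bar>q t\<bar>) + 1)\<^sup>2) * integral {0..} (\<lambda>t. (phi t)\<^sup>2)"
proof -
  \<comment> \<open>The added 1 makes division by \<open>A\<close> safe even if \<open>q\<close>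
    vanishes.\<close>
  define A where "A = integral {0..} (\<lambda>t. \<bar>q t\<bar>) + 1"
  define T where "T = integral {0..} (\<lambda>t. (dphi t)\<^sup>2)"
  define N where "N = integral {0..} (\<lambda>t. (phi t)\<^sup>2)"
  define V where "V = integral {0..} (\<lambda>t. t * (phi t)\<^sup>2)"
  have ints: "(\<lambda>t. (dphi t)\<^sup>2) integrable_on {0..}" "(\<lambda>t. (phi t)\<^sup>2) integrable_on {0..}"
    "(\<lambda>t. t * (phi t)\<^sup>2) integrable_on {0..}" "(\<lambda>t. q t * (phi t)\<^sup>2) integrable_on {0..}"
    using dphi_sq phi_sq x_phi_sq q_phi_sq by (auto simp: set_lebesgue_integral_eq_integral)
  have T0: "0 \<le> T" and N0: "0 \<le> N" unfolding T_def N_def by (intro integral_nonneg ints; simp)+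
  have A: "A \<ge> 1" unfolding A_def using q_tail_integrable[of 0] by (simp add: integral_nonneg)
  have "((\<lambda>t. (dphi t)\<^sup>2 + (t * (phi t)\<^sup>2 - lam * (phi t)\<^sup>2)) has_integral (T + (V - lam * N))) {0..}"
    unfolding T_def V_def N_def
    by (intro has_integral_add has_integral_diff has_integral_mult_right integrable_integral ints)
  then have "integral {0..} (\<lambda>t. (dphi t)\<^sup>2 + (t - lam) * (phi t)\<^sup>2) = T + (V - lam * N)"
    by (auto simp: algebra_simps dest: integral_unique)
  then have eq: "T + (V - lam * N) + integral {0..} (\<lambda>t. q t * (phi t)\<^sup>2) = 0"
    using prod_tail[of 0] by (simp add: phi0)
  \<comment> \<open>This is \<open>sup_bound\<close> with \<open>s = 2 * A\<close>, chosen so that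
    \<open>B * A\<close> contains \<open>T / 2\<close>.\<close>
  define B where "B = T / (2 * A) + 2 * A * N"
  have "norm (integral {0..} (\<lambda>t. q t * (phi t)\<^sup>2)) \<le> integral {0..} (\<lambda>t. B * \<bar>q t\<bar>)"
  proof (rule integral_norm_bound_integral[OF ints(4)])
    show "(\<lambda>t. B * \<bar>q t\<bar>) integrable_on {0..}"
      by (intro integrable_on_mult_right q_tail_integrable) simp
    fix t :: real assume "t \<in> {0..}"
    then have "(phi t)\<^sup>2 \<le> B"
      unfolding B_def T_def N_def using A by (intro sup_bound) auto
    then have "(phi t)\<^sup>2 * \<bar>q t\<bar> \<le> B * \<bar>q t\<bar>" by (intro mult_right_mono) auto
    then show "norm (q t * (phi t)\<^sup>2) \<le> B * \<bar>q t\<bar>" by (simp add: abs_mult mult_ac)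
  qed
  also have "\<dots> = B * (A - 1)" by (simp add: A_def)
  also have "\<dots> \<le> B * A" using T0 N0 A by (intro mult_left_mono) (auto simp: B_def)
  also have "\<dots> = T / 2 + 2 * A\<^sup>2 * N" using A by (simp add: B_def field_simps power2_eq_square)
  finally have "- integral {0..} (\<lambda>t. q t * (phi t)\<^sup>2) \<le> T / 2 + 2 * A\<^sup>2 * N" by simp
  with eq have "T / 2 + V \<le> (lam + 2 * A\<^sup>2) * N" by (simp add: algebra_simps)
  then show ?thesis by (simp add: A_def T_def N_def V_def)
qed

text \<open>A Cauchy-Schwarz estimate with the square root traded for a parameter: the integrand
  bound is \<open>\<bar>dphi t\<bar> \<le> s * (dphi t)\<^sup>2 + 1 / s\<close>.\<close>

lemma modulus_of_continuity:
  assumes xy: "0 \<le> x" "x \<le> y" and s: "0 < s"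
  shows "\<bar>phi y - phi x\<bar> \<le> s * integral {0..} (\<lambda>t. (dphi t)\<^sup>2) + (y - x) / s"
proof -
  have d: "(\<lambda>t. (dphi t)\<^sup>2) integrable_on {0..}"
    using dphi_sq by (simp add: set_lebesgue_integral_eq_integral)
  have dxy: "(\<lambda>t. (dphi t)\<^sup>2) integrable_on {x..y}"
    using d by (rule integrable_on_subinterval) (use xy in auto)
  have hi: "((\<lambda>t. s * (dphi t)\<^sup>2 + 1 / s) has_integral
      (s * integral {x..y} (\<lambda>t. (dphi t)\<^sup>2) + (y - x) / s)) {x..y}"
    using has_integral_const_real[of "1 / s" x y] xy
    by (intro has_integral_add has_integral_mult_right integrable_integral dxy) simp
  have "\<bar>phi y - phi x\<bar> \<le> integral {x..y} (\<lambda>t. s * (dphi t)\<^sup>2 + 1 / s)"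
  proof (rule primitive_of_bound[OF phi xy])
    show "(\<lambda>t. s * (dphi t)\<^sup>2 + 1 / s) integrable_on {x..y}" using hi by blast
    fix t
    have "2 * \<bar>1 * dphi t\<bar> * (1 / s) \<le> (dphi t)\<^sup>2 + (1 / s)\<^sup>2 * 1\<^sup>2"
      using s by (intro weighted_am_gm) auto
    then have "2 * \<bar>dphi t\<bar> \<le> s * (dphi t)\<^sup>2 + 1 / s"
      using s by (simp add: field_simps power2_eq_square)
    then show "\<bar>dphi t\<bar> \<le> s * (dphi t)\<^sup>2 + 1 / s" by linarith
  qed
  also have "\<dots> = s * integral {x..y} (\<lambda>t. (dphi t)\<^sup>2) + (y - x) / s"
    using hi by (rule integral_unique)
  also have "\<dots> \<le> s * integral {0..} (\<lambda>t. (dphi t)\<^sup>2) + (y - x) / s"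
    using s xy by (intro add_right_mono mult_left_mono integral_subset_le dxy d) auto
  finally show ?thesis .
qed

end

section \<open>From eigenpairs to normalized solutions, and growth of the eigenvalues\<close>

lemma dirichlet_eigenpair_stark_solution:
  assumes q: "q absolutely_integrable_on {0<..}" and "dirichlet_eigenpair q lam phi dphi"
  shows "stark_solution q lam phi dphi"
proof
  show "q absolutely_integrable_on {0..}"
  proof (rule absolutely_integrable_spike_set[OF q])
    show "negligible {x \<in> {0..} - {0<..}. q x \<noteq> 0}"
      by (rule negligible_subset[of "{0}"]) auto
    show "negligible {x \<in> {0<..} - {0..}. q x \<noteq> 0}"
      by (rule negligible_subset[of "{}"]) auto
  qed
  show d: "primitive_of dphi (\<lambda>t. (t + q t - lam) * phi t)"
    using assms(2) by (auto simp: dirichlet_eigenpair_def primitive_of_def)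
  \<comment> \<open>Being a primitive, \<open>dphi\<close> is continuous, so the fundamental theorem
    of calculus applies to \<open>phi\<close>.\<close>
  show "primitive_of phi dphi"
    using assms(2) primitive_of_continuous[OF d]
    by (intro primitive_of_deriv) (auto simp: dirichlet_eigenpair_def)
  show "(\<lambda>x. (phi x)\<^sup>2) absolutely_integrable_on {0..}"
    using assms(2) by (intro nonnegative_absolutely_integrable_1) (auto simp: dirichlet_eigenpair_def)
qed (use assms(2) in \<open>auto simp: dirichlet_eigenpair_def\<close>)

lemma normalized_eigenfunction:
  assumes q: "q absolutely_integrable_on {0<..}" and "dirichlet_eigenvalue q lam"
  obtains phi dphi where "stark_solution q lam phi dphi" "integral {0..} (\<lambda>x. (phi x)\<^sup>2) = 1"
proof -
  obtain psi dpsi where "dirichlet_eigenpair q lam psi dpsi"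
    using assms(2) by (auto simp: dirichlet_eigenvalue_def)
  then interpret stark_solution q lam psi dpsi
    using dirichlet_eigenpair_stark_solution[OF q] by blast
  define c where "c = 1 / sqrt (integral {0..} (\<lambda>x. (psi x)\<^sup>2))"
  have "c \<noteq> 0" "c\<^sup>2 * integral {0..} (\<lambda>x. (psi x)\<^sup>2) = 1"
    using phi_sq_integral_pos by (auto simp: c_def power_divide)
  then show ?thesis
    using that[OF scaled[of c]] by (simp add: power_mult_distrib)
qed

text \<open>Normalized eigenfunctions with bounded eigenvalues are equicontinuous and have uniformly small
  tails, so two of them would be close in the mean, although they are orthogonal.\<close>

lemma eigenvalues_unbounded:
  fixes lam :: "nat \<Rightarrow> real"
  assumes q: "q absolutely_integrable_on {0<..}" and inj: "inj lam"
    and ev: "\<And>k. dirichlet_eigenvalue q (lam k)"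
  shows "\<exists>k. lam k > L"
proof (rule ccontr)
  assume "\<not> ?thesis"
  then have L: "lam k \<le> L" for k by (meson not_le)
  define Q where "Q k f df \<longleftrightarrow> stark_solution q (lam k) f df \<and> integral {0..} (\<lambda>x. (f x)\<^sup>2) = 1"
    for k f df
  have "\<exists>f df. Q k f df" for k
    by (rule normalized_eigenfunction[OF q ev[of k]]) (auto simp: Q_def)
  then obtain u du where "\<And>k. Q k (u k) (du k)"
    by metis
  then have u: "\<And>k. stark_solution q (lam k) (u k) (du k)"
    and u1: "\<And>k. integral {0..} (\<lambda>x. (u k x)\<^sup>2) = 1"
    by (auto simp: Q_def)
  define C where "C = max 1 (L + 2 * (integral {0..} (\<lambda>t. \<bar>q t\<bar>) + 1)\<^sup>2)"
  have C1: "C \<ge> 1" by (simp add: C_def)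
  have int_sq: "(\<lambda>t. (u k t)\<^sup>2) integrable_on {0..}"
    and int_dsq: "(\<lambda>t. (du k t)\<^sup>2) integrable_on {0..}"
    and int_xsq: "(\<lambda>t. t * (u k t)\<^sup>2) integrable_on {0..}" for k
    using stark_solution.phi_sq[OF u] stark_solution.dphi_sq[OF u] stark_solution.x_phi_sq[OF u]
    by (auto simp: set_lebesgue_integral_eq_integral)
  have T0: "0 \<le> integral {0..} (\<lambda>t. (du k t)\<^sup>2)" and V0: "0 \<le> integral {0..} (\<lambda>t. t * (u k t)\<^sup>2)" for k
    by (auto intro!: integral_nonneg int_dsq int_xsq)
  have E: "integral {0..} (\<lambda>t. (du k t)\<^sup>2) / 2 + integral {0..} (\<lambda>t. t * (u k t)\<^sup>2) \<le> C" for k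
    using stark_solution.energy_bound[OF u, of k] L[of k] by (auto simp: u1 C_def)
  have T: "integral {0..} (\<lambda>t. (du k t)\<^sup>2) \<le> 2 * C"
    and V: "integral {0..} (\<lambda>t. t * (u k t)\<^sup>2) \<le> C" for k
    using E[of k] T0[of k] V0[of k] by linarith+
  have sup: "norm (u k x) \<le> 2 * C + 2" if "0 \<le> x" for k x
  proof -
    have "(u k x)\<^sup>2 \<le> 2 * C + 1"
      using stark_solution.sup_bound[OF u that, of 1 k] T[of k] by (simp add: u1)
    also have "\<dots> \<le> (2 * C + 2)\<^sup>2" using C1 by (simp add: power2_eq_square algebra_simps)
    finally show ?thesis using C1 by (simp add: abs_le_square_iff[symmetric])
  qed
  have modc: "\<bar>u k y - u k x\<bar> \<le> s * (2 * C) + \<bar>y - x\<bar> / s" if "0 \<le> x" "0 \<le> y" "0 < s" for k x y s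
  proof -
    have *: "\<bar>u k b - u k a\<bar> \<le> s * (2 * C) + (b - a) / s" if "0 \<le> a" "a \<le> b" for a b
      using stark_solution.modulus_of_continuity[OF u that \<open>0 < s\<close>, of k] mult_left_mono[OF T[of k], of s] \<open>0 < s\<close>
      by linarith
    show ?thesis using *[of x y] *[of y x] that by (cases "x \<le> y") (auto simp: abs_minus_commute)
  qed
  \<comment> \<open>The squared difference of two eigenfunctions has mass at most
    \<open>4 * C / X\<close> beyond \<open>X\<close>, which is then 1/2.\<close>
  define X where "X = 8 * C"
  obtain g r where r: "strict_mono (r :: nat \<Rightarrow> nat)"
    and lim: "\<And>e. 0 < e \<Longrightarrow> \<exists>N. \<forall>n x. n \<ge> N \<and> x \<in> {0..X} \<longrightarrow> norm (u (r n) x - g x) < e"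
  proof (rule Arzela_Ascoli[of "{0..X}" u "2 * C + 2"])
    fix x e :: real assume x: "x \<in> {0..X}" and e: "0 < e"
    \<comment> \<open>Then \<open>s * (2 * C)\<close> is \<open>e / 4\<close>, and points closer
      than \<open>s * (e / 4)\<close> make the other term of \<open>modc\<close> smaller than
      \<open>e / 4\<close>.\<close>
    define s where "s = e / (8 * C)"
    have s: "s > 0" using e C1 by (simp add: s_def)
    have "norm (u n x - u n y) < e" if "y \<in> {0..X}" "norm (x - y) < s * (e / 4)" for n y
    proof -
      have "\<bar>u n x - u n y\<bar> \<le> s * (2 * C) + \<bar>x - y\<bar> / s"
        using that x s by (intro modc) auto
      also have "s * (2 * C) = e / 4" using C1 by (simp add: s_def)
      also have "\<bar>x - y\<bar> / s < e / 4" using that(2) s by (simp add: field_simps)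
      finally show ?thesis using e by simp
    qed
    then show "\<exists>d>0. \<forall>n y. y \<in> {0..X} \<and> norm (x - y) < d \<longrightarrow> norm (u n x - u n y) < e"
      using s e by (intro exI[of _ "s * (e / 4)"]) auto
  qed (use sup in auto)
  \<comment> \<open>A uniform distance \<open>d\<close> on \<open>{0..X}\<close> contributes at most
    \<open>X * d\<^sup>2\<close>, that is \<open>1 / (4 * X)\<close>. Each of the two functions is
    taken within \<open>d / 2\<close> of the limit \<open>g\<close>.\<close>
  define d where "d = 1 / (2 * X)"
  have X8: "X \<ge> 8" using C1 by (simp add: X_def)
  then have d0: "d > 0" by (simp add: d_def)
  obtain N where N: "\<And>n x. n \<ge> N \<Longrightarrow> x \<in> {0..X} \<Longrightarrow> norm (u (r n) x - g x) < d / 2"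
    using lim[of "d / 2"] d0 by auto
  define i j where "i = r N" and "j = r (Suc N)"
  have "i < j" using r by (simp add: i_def j_def strict_mono_def)
  then have ne: "lam i \<noteq> lam j" using inj by (auto simp: inj_eq)
  have close: "\<bar>u i x - u j x\<bar> \<le> d" if "x \<in> {0..X}" for x
    using N[of N x] N[of "Suc N" x] that unfolding i_def j_def real_norm_def by linarith
  have prod: "(\<lambda>x. u i x * u j x) absolutely_integrable_on {0..}"
    by (intro square_integrable_product stark_solution.cont[OF u] stark_solution.phi_sq[OF u])
  \<comment> \<open>Orthonormal functions have squared distance 2, while the two pieces bounded
    below add up to at most 1.\<close>
  have "((\<lambda>x. (u i x)\<^sup>2 + (u j x)\<^sup>2 - 2 * (u i x * u j x)) has_integral 1 + 1 - 2 * 0) {0..}"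
  proof (intro has_integral_add has_integral_diff has_integral_mult_right)
    show "((\<lambda>x. (u i x)\<^sup>2) has_integral 1) {0..}" "((\<lambda>x. (u j x)\<^sup>2) has_integral 1) {0..}"
      using integrable_integral[OF int_sq] u1 by metis+
    show "((\<lambda>x. u i x * u j x) has_integral 0) {0..}"
      using eigenfunctions_orthogonal[OF u u ne] prod
      by (simp add: has_integral_iff set_lebesgue_integral_eq_integral)
  qed
  then have two: "((\<lambda>x. (u i x - u j x)\<^sup>2) has_integral 2) {0..}"
    by (simp add: power2_diff mult.assoc algebra_simps)
  then have diff: "(\<lambda>x. (u i x - u j x)\<^sup>2) absolutely_integrable_on {0..}"
    by (intro nonnegative_absolutely_integrable_1) auto
  have parts: "(\<lambda>x. (u i x - u j x)\<^sup>2) integrable_on {0..X}" "(\<lambda>x. (u i x - u j x)\<^sup>2) integrable_on {X..}"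
    using diff X8 by (auto intro!: set_lebesgue_integral_eq_integral(1) intro: set_integrable_subset)
  have "integral {0..X} (\<lambda>x. (u i x - u j x)\<^sup>2) \<le> integral {0..X} (\<lambda>x. d\<^sup>2)"
    using close d0 by (intro integral_le parts) (auto simp: abs_le_square_iff[symmetric])
  also have "\<dots> = 1 / (4 * X)" using X8 by (simp add: d_def power2_eq_square field_simps)
  also have "\<dots> \<le> 1 / 2" using X8 by (simp add: field_simps)
  finally have near: "integral {0..X} (\<lambda>x. (u i x - u j x)\<^sup>2) \<le> 1 / 2" .
  \<comment> \<open>On the tail \<open>x / X \<ge> 1\<close>, so \<open>h\<close> dominates twice
    the sum of the squares, and its integral is controlled by the potential energies in
    \<open>V\<close>.\<close>
  define h where "h = (\<lambda>x. 2 / X * (x * (u i x)\<^sup>2 + x * (u j x)\<^sup>2))"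
  have hh: "(h has_integral 2 / X * (integral {0..} (\<lambda>t. t * (u i t)\<^sup>2) + integral {0..} (\<lambda>t. t * (u j t)\<^sup>2))) {0..}"
    unfolding h_def by (intro has_integral_mult_right has_integral_add integrable_integral int_xsq)
  have h0: "0 \<le> h x" if "0 \<le> x" for x using that X8 by (simp add: h_def)
  have ha: "h absolutely_integrable_on {0..}"
    using hh h0 by (intro nonnegative_absolutely_integrable_1) auto
  have hX: "h integrable_on {X..}"
    using abs_integrable_atLeast_mono[OF ha, of X] X8 by (simp add: set_lebesgue_integral_eq_integral)
  have "integral {X..} (\<lambda>x. (u i x - u j x)\<^sup>2) \<le> integral {X..} h"
  proof (rule integral_le[OF parts(2) hX])
    fix x assume x: "x \<in> {X..}"
    have "(u i x - u j x)\<^sup>2 + (u i x + u j x)\<^sup>2 = 2 * ((u i x)\<^sup>2 + (u j x)\<^sup>2)"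
      by (simp add: power2_eq_square algebra_simps)
    then have "(u i x - u j x)\<^sup>2 \<le> 2 * ((u i x)\<^sup>2 + (u j x)\<^sup>2)"
      using zero_le_power2[of "u i x + u j x"] by linarith
    also have "\<dots> = 1 * (2 * ((u i x)\<^sup>2 + (u j x)\<^sup>2))" by simp
    also have "\<dots> \<le> (x / X) * (2 * ((u i x)\<^sup>2 + (u j x)\<^sup>2))"
      using x X8 by (intro mult_right_mono) auto
    also have "\<dots> = h x" by (simp add: h_def algebra_simps)
    finally show "(u i x - u j x)\<^sup>2 \<le> h x" .
  qed
  also have "\<dots> \<le> integral {0..} h"
    using X8 hh h0 by (intro integral_subset_le hX) auto
  also have "\<dots> = 2 / X * (integral {0..} (\<lambda>t. t * (u i t)\<^sup>2) + integral {0..} (\<lambda>t. t * (u j t)\<^sup>2))"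
    using hh by (rule integral_unique)
  also have "\<dots> \<le> 2 / X * (C + C)" using X8 V by (intro mult_left_mono add_mono) auto
  also have "\<dots> = 1 / 2" using C1 by (simp add: X_def)
  finally have far: "integral {X..} (\<lambda>x. (u i x - u j x)\<^sup>2) \<le> 1 / 2" .
  have "2 = integral {0..X} (\<lambda>x. (u i x - u j x)\<^sup>2) + integral {X..} (\<lambda>x. (u i x - u j x)\<^sup>2)"
    using integral_atLeast_split[OF diff, of X] X8 integral_unique[OF two] by simp
  with near far show False by simp
qed

text \<open>The sequence \<open>lam\<close> lists the eigenvalues increasingly from index 0, a shift
  that does not affect the limit. The index \<open>K\<close> precedes the quantifier over
  eigenpairs, so it serves every choice of eigenfunction.\<close>

theorem theorem3p6:
  fixes q :: "real \<Rightarrow> real" and lam :: "nat \<Rightarrow> real"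
  assumes "q absolutely_integrable_on {0<..}"
    and "strict_mono lam"
    and "{l. dirichlet_eigenvalue q l} = range lam"
  shows "\<forall>e>0. \<exists>K. \<forall>k\<ge>K. \<forall>phi dphi. dirichlet_eigenpair q (lam k) phi dphi \<longrightarrow>
           \<bar>integral {0..} (\<lambda>x. (phi x)\<^sup>2) / (dphi 0)\<^sup>2 - 1\<bar> < e"
proof (intro allI impI)
  fix e :: real assume e: "e > 0"
  have ev: "dirichlet_eigenvalue q (lam k)" for k
    using assms(3) by blast
  have q: "q absolutely_integrable_on {0..}"
    using ev[of 0] dirichlet_eigenpair_stark_solution[OF assms(1)] stark_solution.q
    by (metis dirichlet_eigenvalue_def)
  define A where "A = integral {0..} (\<lambda>t. \<bar>q t\<bar>)"
  have A0: "A \<ge> 0"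
    unfolding A_def using q by (intro integral_nonneg) (auto simp: absolutely_integrable_on_def)
  obtain X where X: "\<And>x. x \<ge> X \<Longrightarrow> integral {x..} (\<lambda>t. \<bar>q t\<bar>) < min (1/64) (e/256)"
    using abs_integrable_tail_small[OF q, of "min (1/64) (e/256)"] e by auto
  \<comment> \<open>Once \<open>sqrt (lam k / 2)\<close> reaches \<open>M\<close>, the summand
    \<open>4 * A\<close> yields the hypothesis on the total mass of \<open>\<bar>q\<bar>\<close>,
    and \<open>8 * A / e\<close> yields \<open>A / r \<le> e / 8\<close>. The bound
    \<open>e/256\<close> on the tail likewise makes \<open>32 * tl\<close> less than
    \<open>e / 8\<close>.\<close>
  define M where "M = 4 * A + 8 * A / e + 1"
  define L where "L = max 2 (max (2 * X) (2 * M\<^sup>2))"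
  obtain K where K: "lam K > L"
    using eigenvalues_unbounded[OF assms(1) strict_mono_imp_inj_on[OF assms(2)] ev] by blast
  show "\<exists>K. \<forall>k\<ge>K. \<forall>phi dphi. dirichlet_eigenpair q (lam k) phi dphi \<longrightarrow>
           \<bar>integral {0..} (\<lambda>x. (phi x)\<^sup>2) / (dphi 0)\<^sup>2 - 1\<bar> < e"
  proof (intro exI[of _ K] allI impI)
    fix k phi dphi assume k: "K \<le> k" and "dirichlet_eigenpair q (lam k) phi dphi"
    then interpret stark_solution q "lam k" phi dphi
      using dirichlet_eigenpair_stark_solution[OF assms(1)] by blast
    define N where "N = integral {0..} (\<lambda>x. (phi x)\<^sup>2)"
    define D where "D = (dphi 0)\<^sup>2"
    define r where "r = sqrt (lam k / 2)"
    define tl where "tl = integral {lam k / 2..} (\<lambda>t. \<bar>q t\<bar>)"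
    have "lam K \<le> lam k" using assms(2) k by (simp add: strict_mono_less_eq)
    then have l: "lam k \<ge> 2" "lam k / 2 \<ge> X" "lam k / 2 \<ge> M\<^sup>2" using K by (auto simp: L_def)
    have M1: "M \<ge> 1" using A0 e by (simp add: M_def)
    have rM: "r \<ge> M" unfolding r_def using l(3) by (rule real_le_rsqrt)
    have "4 * A \<le> M" "8 * A / e \<le> M" using A0 e by (auto simp: M_def)
    then have rA: "A \<le> r / 4" "8 * A / e \<le> r" using rM by auto
    have t: "tl < 1/64" "tl < e/256" using X[OF l(2)] by (auto simp: tl_def)
    have dev: "\<bar>N - D\<bar> \<le> 2 * D * (A / r + 32 * tl)"
      unfolding N_def D_def r_def A_def tl_def
      using l rA t by (intro norm_deviation) (auto simp: A_def r_def tl_def)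
    \<comment> \<open>If \<open>D\<close> were 0, the deviation bound would force
      \<open>N = 0\<close>, but the norm is positive. Hence the quotient in the conclusion is a
      genuine one.\<close>
    have "D \<noteq> 0" using dev phi_sq_integral_pos by (auto simp: N_def)
    then have D: "D > 0" by (simp add: D_def)
    have "A / r \<le> e / 8" using rA(2) rM M1 e by (simp add: field_simps)
    then have "A / r + 32 * tl < e / 8 + e / 8" using t(2) by (intro add_le_less_mono) auto
    then have "2 * (A / r + 32 * tl) < 2 * (e / 8 + e / 8)" by (intro mult_strict_left_mono) auto
    then have "2 * (A / r + 32 * tl) < e" using e by simp
    then have "2 * D * (A / r + 32 * tl) < D * e" using D by (simp add: mult.commute mult.left_commute)
    then have "\<bar>N - D\<bar> < D * e" using dev by simp
    moreover have "\<bar>N / D - 1\<bar> = \<bar>N - D\<bar> / D"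
    proof -
      have "N / D - 1 = (N - D) / D" using D by (simp add: field_simps)
      then show ?thesis using D by simp
    qed
    ultimately show "\<bar>integral {0..} (\<lambda>x. (phi x)\<^sup>2) / (dphi 0)\<^sup>2 - 1\<bar> < e"
      using D by (simp add: N_def D_def field_simps)
  qed
qed

end
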